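(* Let $\Bbbk$ be an algebraically closed field and $A$ a finite dimensional selfinjective $\Bbbk$-algebra. Then $\operatorname{HHdim} T(A)=\infty$.
   Context: $T(A)=A\ltimes DA$ is the trivial extension: the vector space $A\oplus DA$, where $DA=\operatorname{Hom}_\Bbbk(A,\Bbbk)$ with its natural bimodule structure, with multiplication $(a,f)(b,g)=(ab,ag+fb)$. For a finite dimensional algebra $B$, $\operatorname{HH}_n(B)=\operatorname{Tor}^{B\otimes_\Bbbk B^{\mathrm{op}}}_n(B,B)$ is the $n$-th Hochschild homology group, and $\operatorname{HHdim}B=\sup\{n\mid \operatorname{HH}_n(B)\neq 0\}$. *)

theory Defs
  imports "HOL-Computational_Algebra.Polynomial"
begin

definition alg_closed :: "'k::field itself \<Rightarrow> bool" where
  "alg_closed _ \<longleftrightarrow> (\<forall>p :: 'k poly. degree p > 0 \<longrightarrow> (\<exists>x. poly p x = 0))"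

text \<open>A finite dimensional k-algebra of dimension d is given by structure constants
  w.r.t. a basis e_0..e_(d-1):  e_i e_j = sum_l c i j l e_l.  Elements are coefficient
  vectors nat => k supported on {..<d}.\<close>

definition vecs :: "nat \<Rightarrow> (nat \<Rightarrow> 'k::field) set" where
  "vecs d = {v. \<forall>i. d \<le> i \<longrightarrow> v i = 0}"

definition amul :: "(nat \<Rightarrow> nat \<Rightarrow> nat \<Rightarrow> 'k::field) \<Rightarrow> nat \<Rightarrow> (nat \<Rightarrow> 'k) \<Rightarrow> (nat \<Rightarrow> 'k) \<Rightarrow> (nat \<Rightarrow> 'k)" where
  "amul c d x y = (\<lambda>l. if l < d then (\<Sum>i<d. \<Sum>j<d. x i * y j * c i j l) else 0)"

definition fd_algebra :: "nat \<Rightarrow> (nat \<Rightarrow> nat \<Rightarrow> nat \<Rightarrow> 'k::field) \<Rightarrow> bool" where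
  "fd_algebra d c \<longleftrightarrow>
     (\<forall>i<d. \<forall>j<d. \<forall>l<d. \<forall>m<d.
        (\<Sum>p<d. c i j p * c p l m) = (\<Sum>p<d. c j l p * c i p m)) \<and>
     (\<exists>u \<in> vecs d. \<forall>i<d. \<forall>m<d.
        (\<Sum>p<d. u p * c p i m) = (if i = m then 1 else 0) \<and>
        (\<Sum>p<d. u p * c i p m) = (if i = m then 1 else 0))"

text \<open>Right ideals and selfinjectivity (A_A injective), via Baer's criterion:
  every right A-linear map from a right ideal I into A_A is left multiplication
  by an element of A.\<close>

definition right_ideal :: "nat \<Rightarrow> (nat \<Rightarrow> nat \<Rightarrow> nat \<Rightarrow> 'k::field) \<Rightarrow> (nat \<Rightarrow> 'k) set \<Rightarrow> bool" where
  "right_ideal d c I \<longleftrightarrow> I \<subseteq> vecs d \<and> (\<lambda>_. 0) \<in> I \<and>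
     (\<forall>x\<in>I. \<forall>y\<in>I. (\<lambda>i. x i + y i) \<in> I) \<and>
     (\<forall>x\<in>I. \<forall>s. (\<lambda>i. s * x i) \<in> I) \<and>
     (\<forall>x\<in>I. \<forall>a\<in>vecs d. amul c d x a \<in> I)"

definition right_hom :: "nat \<Rightarrow> (nat \<Rightarrow> nat \<Rightarrow> nat \<Rightarrow> 'k::field) \<Rightarrow> (nat \<Rightarrow> 'k) set
     \<Rightarrow> ((nat \<Rightarrow> 'k) \<Rightarrow> (nat \<Rightarrow> 'k)) \<Rightarrow> bool" where
  "right_hom d c I f \<longleftrightarrow> (\<forall>x\<in>I. f x \<in> vecs d) \<and>
     (\<forall>x\<in>I. \<forall>y\<in>I. f (\<lambda>i. x i + y i) = (\<lambda>i. f x i + f y i)) \<and>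
     (\<forall>x\<in>I. \<forall>s. f (\<lambda>i. s * x i) = (\<lambda>i. s * f x i)) \<and>
     (\<forall>x\<in>I. \<forall>a\<in>vecs d. f (amul c d x a) = amul c d (f x) a)"

definition selfinjective :: "nat \<Rightarrow> (nat \<Rightarrow> nat \<Rightarrow> nat \<Rightarrow> 'k::field) \<Rightarrow> bool" where
  "selfinjective d c \<longleftrightarrow>
     (\<forall>I f. right_ideal d c I \<longrightarrow> right_hom d c I f \<longrightarrow>
        (\<exists>a\<in>vecs d. \<forall>x\<in>I. f x = amul c d a x))"

text \<open>Trivial extension T(A) = A \<ltimes> DA: basis e_0..e_(d-1) of A followed by the dual
  basis phi_0..phi_(d-1) of DA (index d+j).  With (a f)(x) = f(x a), (f b)(x) = f(b x):
  e_i phi_j = sum_m c m i j phi_m,  phi_j e_i = sum_m c i m j phi_m,  phi phi = 0.\<close>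

definition triv_ext :: "nat \<Rightarrow> (nat \<Rightarrow> nat \<Rightarrow> nat \<Rightarrow> 'k::field) \<Rightarrow> (nat \<Rightarrow> nat \<Rightarrow> nat \<Rightarrow> 'k)" where
  "triv_ext d c i j l =
     (if i < d \<and> j < d \<and> l < d then c i j l
      else if i < d \<and> d \<le> j \<and> j < 2*d \<and> d \<le> l \<and> l < 2*d then c (l - d) i (j - d)
      else if d \<le> i \<and> i < 2*d \<and> j < d \<and> d \<le> l \<and> l < 2*d then c j (l - d) (i - d)
      else 0)"

text \<open>Hochschild complex C_n(B) = B^{\<otimes>(n+1)}, with basis the tensors of basis vectors,
  indexed by lists of length n+1 with entries < d.\<close>

definition tuples :: "nat \<Rightarrow> nat \<Rightarrow> nat list set" where
  "tuples d n = {u. length u = n + 1 \<and> set u \<subseteq> {..<d}}"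

definition chain :: "nat \<Rightarrow> nat \<Rightarrow> (nat list \<Rightarrow> 'k::field) \<Rightarrow> bool" where
  "chain d n x \<longleftrightarrow> (\<forall>u. u \<notin> tuples d n \<longrightarrow> x u = 0)"

text \<open>Coefficient of basis tensor w (length n+1) in b(e_u), u of length n+2, where
  b(a_0 \<otimes>..\<otimes> a_(n+1)) = sum_(k=0..n) (-1)^k a_0\<otimes>..\<otimes>a_k a_(k+1)\<otimes>..
                          + (-1)^(n+1) a_(n+1) a_0 \<otimes> a_1 \<otimes>..\<otimes> a_n.\<close>
definition hoch_coeff :: "(nat \<Rightarrow> nat \<Rightarrow> nat \<Rightarrow> 'k::field) \<Rightarrow> nat \<Rightarrow> nat list \<Rightarrow> nat list \<Rightarrow> 'k" where
  "hoch_coeff c n u w =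
     (\<Sum>k\<le>n. (-1) ^ k *
        (if take k w = take k u \<and> drop (k+1) w = drop (k+2) u then c (u!k) (u!(k+1)) (w!k) else 0))
     + (-1) ^ (n+1) *
        (if drop 1 w = take n (drop 1 u) then c (u!(n+1)) (u!0) (w!0) else 0)"

definition hoch_d :: "nat \<Rightarrow> (nat \<Rightarrow> nat \<Rightarrow> nat \<Rightarrow> 'k::field) \<Rightarrow> nat \<Rightarrow> (nat list \<Rightarrow> 'k) \<Rightarrow> (nat list \<Rightarrow> 'k)" where
  "hoch_d d c n x = (\<lambda>w. if w \<in> tuples d n then (\<Sum>u\<in>tuples d (Suc n). x u * hoch_coeff c n u w) else 0)"

definition hoch_cycles :: "nat \<Rightarrow> (nat \<Rightarrow> nat \<Rightarrow> nat \<Rightarrow> 'k::field) \<Rightarrow> nat \<Rightarrow> (nat list \<Rightarrow> 'k) set" where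
  "hoch_cycles d c n = {x. chain d n x \<and> (n = 0 \<or> hoch_d d c (n - 1) x = (\<lambda>_. 0))}"

definition hoch_boundaries :: "nat \<Rightarrow> (nat \<Rightarrow> nat \<Rightarrow> nat \<Rightarrow> 'k::field) \<Rightarrow> nat \<Rightarrow> (nat list \<Rightarrow> 'k) set" where
  "hoch_boundaries d c n = {hoch_d d c n y | y. chain d (Suc n) y}"

definition HH_nonzero :: "nat \<Rightarrow> (nat \<Rightarrow> nat \<Rightarrow> nat \<Rightarrow> 'k::field) \<Rightarrow> nat \<Rightarrow> bool" where
  "HH_nonzero d c n \<longleftrightarrow> \<not> (hoch_cycles d c n \<subseteq> hoch_boundaries d c n)"

definition HHdim_infinite :: "nat \<Rightarrow> (nat \<Rightarrow> nat \<Rightarrow> nat \<Rightarrow> 'k::field) \<Rightarrow> bool" where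
  "HHdim_infinite d c \<longleftrightarrow> infinite {n. HH_nonzero d c n}"

end

(*
  Write M = DA and T = T(A), graded with M in degree 1. In homological degree w - 1 and weight w the
  Hochschild complex of T is M^{(x) w}, all of it cycles, and a functional on it vanishes on
  boundaries iff it is A-balanced, also across the ends, and is multiplied by (-1)^(w-1) under cyclic
  rotation. Such functionals arise as traces of products of operators m |-> [m] on a module X with
  [am] = a[m] and [ma] = [m]a, that is, from module maps M (x)_A X -> X.

  Since A is selfinjective, every simple left module V embeds in A, so M (x)_A V, whose dual is
  Hom_A(V, A), is nonzero and has a simple quotient V'. Iterating V |-> V', one gets a cycle
  V_0 -> V_1 -> ... -> V_(L-1) -> V_0 of pairwise non-isomorphic simple modules, because over an
  algebraically closed field the matrix coefficients of non-isomorphic simple modules are linearly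
  independent, so that there are only finitely many of them. Let X be the sum of the V_k and twist
  the trace by the sign (-1)^((L-1)k) on V_k. For w an odd multiple of L this gives a functional of
  the required kind, and it is nonzero, again by the independence of matrix coefficients.
*)

theory Submission
  imports Defs "HOL-Library.Function_Algebras" "Jordan_Normal_Form.Char_Poly"
begin

section \<open>Twisted cyclic traces on the Hochschild complex\<close>

text \<open>Selfinjectivity is a statement about right ideals, whereas the V_k are left modules. The
  bridge is that a left ideal of a right selfinjective algebra is the left annihilator of its right
  annihilator: if V = A / I with I proper, then I y = 0 for some nonzero y, and a + I |-> a y embeds
  V in A. By adjunction the dual of M (x)_A V is Hom_A(V, A), because D(DA) = A. So V' is obtained
  as the dual of a simple right submodule of Hom_A(V, A), and the tensor product itself is never
  formed.

  The twist repairs a sign. An untwisted trace is invariant under rotation, but the sign (-1)^(w-1)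
  is required. Each letter moves V_k to V_(k+1), so only words whose length is a multiple of L can
  have nonzero trace, and for even L the required sign is then always -1. Moving a letter across the
  twist costs the factor \<delta> = (-1)^(L-1); around the whole cycle this closes up because L
  (L-1) is even. For an odd multiple w of L the numbers w - 1 and L - 1 have the same parity, so
  \<delta> is exactly the required sign.\<close>

definition mat_mul :: "'i set \<Rightarrow> ('i \<Rightarrow> 'i \<Rightarrow> 'k::field) \<Rightarrow> ('i \<Rightarrow> 'i \<Rightarrow> 'k) \<Rightarrow> 'i \<Rightarrow> 'i \<Rightarrow> 'k" where
  "mat_mul J A B = (\<lambda>x z. \<Sum>y\<in>J. A x y * B y z)"

definition mat_trace :: "'i set \<Rightarrow> ('i \<Rightarrow> 'i \<Rightarrow> 'k::field) \<Rightarrow> 'k" where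
  "mat_trace J A = (\<Sum>x\<in>J. A x x)"

lemma mat_mul_assoc: "mat_mul J (mat_mul J A B) C = mat_mul J A (mat_mul J B C)"
proof (intro ext)
  fix x z
  have "mat_mul J (mat_mul J A B) C x z = (\<Sum>y\<in>J. \<Sum>p\<in>J. A x p * B p y * C y z)"
    by (simp add: mat_mul_def sum_distrib_right)
  also have "\<dots> = (\<Sum>p\<in>J. \<Sum>y\<in>J. A x p * B p y * C y z)"
    by (rule sum.swap)
  also have "\<dots> = mat_mul J A (mat_mul J B C) x z"
    by (simp add: mat_mul_def sum_distrib_left mult.assoc)
  finally show "mat_mul J (mat_mul J A B) C x z = mat_mul J A (mat_mul J B C) x z" .
qed

lemma mat_trace_mul_commute: "mat_trace J (mat_mul J A B) = mat_trace J (mat_mul J B A)"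
  unfolding mat_trace_def mat_mul_def by (subst sum.swap) (simp add: mult.commute)

lemma mat_mul_add_left: "mat_mul J (\<lambda>x z. A x z + B x z) C = (\<lambda>x z. mat_mul J A C x z + mat_mul J B C x z)"
  by (simp add: mat_mul_def algebra_simps sum.distrib)

lemma mat_mul_add_right: "mat_mul J C (\<lambda>x z. A x z + B x z) = (\<lambda>x z. mat_mul J C A x z + mat_mul J C B x z)"
  by (simp add: mat_mul_def algebra_simps sum.distrib)

lemma mat_mul_scale_left: "mat_mul J (\<lambda>x z. s * A x z) C = (\<lambda>x z. s * mat_mul J A C x z)"
  by (simp add: mat_mul_def algebra_simps sum_distrib_left)

lemma mat_mul_sum_left:
  "mat_mul J (\<lambda>x z. \<Sum>l\<in>S. a l * A l x z) C = (\<lambda>x z. \<Sum>l\<in>S. a l * mat_mul J (A l) C x z)"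
proof (intro ext)
  fix x z
  have "mat_mul J (\<lambda>x z. \<Sum>l\<in>S. a l * A l x z) C x z = (\<Sum>y\<in>J. \<Sum>l\<in>S. a l * (A l x y * C y z))"
    by (simp add: mat_mul_def sum_distrib_right mult.assoc)
  also have "\<dots> = (\<Sum>l\<in>S. a l * mat_mul J (A l) C x z)"
    by (subst sum.swap) (simp add: mat_mul_def sum_distrib_left)
  finally show "mat_mul J (\<lambda>x z. \<Sum>l\<in>S. a l * A l x z) C x z = (\<Sum>l\<in>S. a l * mat_mul J (A l) C x z)" .
qed

lemma mat_mul_sum_right:
  "mat_mul J C (\<lambda>x z. \<Sum>l\<in>S. a l * A l x z) = (\<lambda>x z. \<Sum>l\<in>S. a l * mat_mul J C (A l) x z)"
proof (intro ext)
  fix x z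
  have "mat_mul J C (\<lambda>x z. \<Sum>l\<in>S. a l * A l x z) x z = (\<Sum>y\<in>J. \<Sum>l\<in>S. a l * (C x y * A l y z))"
    by (simp add: mat_mul_def sum_distrib_left mult.assoc mult.left_commute)
  also have "\<dots> = (\<Sum>l\<in>S. a l * mat_mul J C (A l) x z)"
    by (subst sum.swap) (simp add: mat_mul_def sum_distrib_left)
  finally show "mat_mul J C (\<lambda>x z. \<Sum>l\<in>S. a l * A l x z) x z = (\<Sum>l\<in>S. a l * mat_mul J C (A l) x z)" .
qed

text \<open>The separate head factor \<open>P\<close> absorbs the letters one at a time, so
  identities that are linear in one factor follow by induction on the rest of the word.\<close>

definition trace_prod :: "'i set \<Rightarrow> ('i \<Rightarrow> 'i \<Rightarrow> 'k::field) \<Rightarrow> ('i \<Rightarrow> 'i \<Rightarrow> 'k) list \<Rightarrow> 'k" where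
  "trace_prod J P As = mat_trace J (foldl (mat_mul J) P As)"

lemma foldl_mat_mul: "foldl (mat_mul J) (mat_mul J A P) As = mat_mul J A (foldl (mat_mul J) P As)"
  by (induction As arbitrary: P) (simp_all add: mat_mul_assoc)

lemma trace_prod_Cons: "trace_prod J P (A # As) = trace_prod J (mat_mul J P A) As"
  by (simp add: trace_prod_def)

lemma trace_prod_add:
  "trace_prod J (\<lambda>x z. A x z + B x z) As = trace_prod J A As + trace_prod J B As"
proof (induction As arbitrary: A B)
  case Nil
  then show ?case by (simp add: trace_prod_def mat_trace_def sum.distrib)
next
  case (Cons C As)
  then show ?case by (simp add: trace_prod_Cons mat_mul_add_left)
qed

lemma trace_prod_scale: "trace_prod J (\<lambda>x z. s * A x z) As = s * trace_prod J A As"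
proof (induction As arbitrary: A)
  case Nil
  then show ?case by (simp add: trace_prod_def mat_trace_def sum_distrib_left)
next
  case (Cons C As)
  then show ?case by (simp add: trace_prod_Cons mat_mul_scale_left)
qed

lemma trace_prod_sum:
  "trace_prod J (\<lambda>x z. \<Sum>l\<in>S. a l * A l x z) As = (\<Sum>l\<in>S. a l * trace_prod J (A l) As)"
proof (induction As arbitrary: A)
  case Nil
  show ?case
    unfolding trace_prod_def mat_trace_def by (simp add: sum_distrib_left) (rule sum.swap)
next
  case (Cons C As)
  then show ?case by (simp add: trace_prod_Cons mat_mul_sum_left)
qed

lemma trace_prod_move:
  "trace_prod J (mat_mul J A P) As = mat_trace J (mat_mul J (foldl (mat_mul J) P As) A)"
  unfolding trace_prod_def foldl_mat_mul by (rule mat_trace_mul_commute)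

lemma alternating_telescope:
  fixes Y :: "nat \<Rightarrow> 'k::comm_ring_1"
  shows "(\<Sum>k\<le>n. (-1) ^ k * (Y k + Y (Suc k))) = Y 0 + (-1) ^ n * Y (Suc n)"
  by (induction n) (simp_all add: algebra_simps)

lemma finite_tuples: "finite (tuples d n)"
  using finite_lists_length_eq[of "{..<d}" "n + 1"] by (simp add: tuples_def conj_commute)

text \<open>\<open>hoch_coeff\<close> describes a face by a condition on the target tuple. The
  tuples that meet it are the \<open>xs @ l # ys\<close>, so pairing a face with a cochain becomes a
  sum over the one merged letter. The cyclic face is the case \<open>k = 0\<close>.\<close>

lemma sum_tuples_replace:
  assumes f: "set (xs @ ys) \<subseteq> {..<d}" and len: "length xs = k" "length (xs @ ys) = n"
  shows "(\<Sum>w\<in>tuples d n. (if take k w = xs \<and> drop (k + 1) w = ys then g (w ! k) else 0) * h w)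
         = (\<Sum>l<d. g l * (h (xs @ l # ys) :: 'k::field))"
proof -
  let ?f = "\<lambda>l. xs @ l # ys"
  have inj: "inj_on ?f {..<d}" by (auto simp: inj_on_def)
  have sub: "?f ` {..<d} \<subseteq> tuples d n" using f len by (auto simp: tuples_def)
  have out: "(if take k w = xs \<and> drop (k + 1) w = ys then g (w ! k) else 0) * h w = 0"
    if w: "w \<in> tuples d n - ?f ` {..<d}" for w
  proof -
    have "False" if c: "take k w = xs" "drop (k + 1) w = ys"
    proof -
      have k: "k < length w" using w len by (auto simp: tuples_def)
      have "w = take k w @ w ! k # drop (Suc k) w" by (rule id_take_nth_drop[OF k])
      with c have e: "w = xs @ w ! k # ys" by simp
      have "w ! k < d" using w nth_mem[OF k] by (auto simp: tuples_def)
      with e w show False by blast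
    qed
    then show ?thesis by auto
  qed
  have "(\<Sum>w\<in>tuples d n. (if take k w = xs \<and> drop (k + 1) w = ys then g (w ! k) else 0) * h w)
      = (\<Sum>w\<in>?f ` {..<d}. (if take k w = xs \<and> drop (k + 1) w = ys then g (w ! k) else 0) * h w)"
    by (rule sum.mono_neutral_right[OF finite_tuples sub]) (use out in blast)
  also have "\<dots> = (\<Sum>l<d. g l * h (xs @ l # ys))"
    unfolding sum.reindex[OF inj] o_def using len by (intro sum.cong) (auto simp: nth_append)
  finally show ?thesis .
qed

text \<open>\<open>R\<close> is the action on the module X and \<open>N\<close> a first-order
  deformation of it: \<open>derivation\<close> is the coefficient of \<epsilon> in the
  multiplicativity of R + \<epsilon> N. In the application \<open>R\<close> kills DA and
  \<open>N\<close> kills A. \<open>D\<close> is the twist, and \<delta> the factor gained when a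
  letter crosses it.\<close>

locale cyclic_trace =
  fixes J :: "'i set" and d :: nat and c :: "nat \<Rightarrow> nat \<Rightarrow> nat \<Rightarrow> 'k::field"
    and R N :: "nat \<Rightarrow> 'i \<Rightarrow> 'i \<Rightarrow> 'k" and D :: "'i \<Rightarrow> 'i \<Rightarrow> 'k" and \<delta> :: 'k
  assumes derivation: "i < d \<Longrightarrow> j < d \<Longrightarrow> (\<lambda>x z. \<Sum>l<d. c i j l * N l x z)
      = (\<lambda>x z. mat_mul J (R i) (N j) x z + mat_mul J (N i) (R j) x z)"
    and commute_R: "i < d \<Longrightarrow> mat_mul J D (R i) = mat_mul J (R i) D"
    and commute_N: "i < d \<Longrightarrow> mat_mul J D (N i) = (\<lambda>x z. \<delta> * mat_mul J (N i) D x z)"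
begin

definition tr_cochain :: "nat list \<Rightarrow> 'k" where
  "tr_cochain u = trace_prod J D (map N u)"

text \<open>Expanding a merged letter by \<open>derivation\<close> leaves two words with a single
  \<open>R\<close>, placed at one or the other of the two letters. Neighbouring faces therefore
  share a term, which is what lets them cancel.\<close>

lemma trace_prod_merge:
  assumes "i < d" "j < d"
  shows "(\<Sum>l<d. c i j l * trace_prod J P (N l # As))
    = trace_prod J (mat_mul J P (R i)) (N j # As) + trace_prod J (mat_mul J (mat_mul J P (N i)) (R j)) As"
proof -
  have "(\<Sum>l<d. c i j l * trace_prod J P (N l # As))
      = trace_prod J (mat_mul J P (\<lambda>x z. \<Sum>l<d. c i j l * N l x z)) As"
    by (simp add: trace_prod_Cons mat_mul_sum_right trace_prod_sum)
  then show ?thesis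
    by (simp add: derivation[OF assms] mat_mul_add_right trace_prod_add trace_prod_Cons mat_mul_assoc)
qed

text \<open>Let \<open>Y k\<close> be the trace of \<open>D N N \<dots> R \<dots> N\<close> with the single \<open>R\<close> in position \<open>k\<close>. The
  derivation property turns the \<open>k\<close>-th face into \<open>Y k + Y (k + 1)\<close> and cyclicity turns the last
  face into \<open>Y (n + 1) + \<delta> Y 0\<close>, so the alternating sum telescopes to zero.\<close>

lemma tr_cochain_boundary:
  assumes u: "u \<in> tuples d (Suc n)" and \<delta>: "\<delta> = (-1) ^ n"
  shows "(\<Sum>w\<in>tuples d n. hoch_coeff c n u w * tr_cochain w) = 0"
proof -
  have len: "length u = n + 2" and set_u: "set u \<subseteq> {..<d}" using u by (auto simp: tuples_def)
  have ud: "u ! k < d" if "k < n + 2" for k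
  proof -
    have "u ! k \<in> set u" using that len by (intro nth_mem) simp
    then show ?thesis using set_u by blast
  qed
  define P where "P k = foldl (mat_mul J) D (map N (take k u))" for k
  define Y where "Y k = trace_prod J (mat_mul J (P k) (R (u ! k))) (map N (drop (k + 1) u))" for k
  have P_Suc: "P (Suc k) = mat_mul J (P k) (N (u ! k))" if "k < n + 2" for k
    using that len by (simp add: P_def take_Suc_conv_app_nth)
  have face: "(\<Sum>w\<in>tuples d n. (if take k w = take k u \<and> drop (k + 1) w = drop (k + 2) u
        then c (u ! k) (u ! (k + 1)) (w ! k) else 0) * tr_cochain w) = Y k + Y (Suc k)"
    if k: "k \<le> n" for k
  proof -
    have "(\<Sum>w\<in>tuples d n. (if take k w = take k u \<and> drop (k + 1) w = drop (k + 2) u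
        then c (u ! k) (u ! (k + 1)) (w ! k) else 0) * tr_cochain w)
      = (\<Sum>l<d. c (u ! k) (u ! (k + 1)) l * tr_cochain (take k u @ l # drop (k + 2) u))"
      by (rule sum_tuples_replace)
         (use k len set_u set_take_subset[of k u] set_drop_subset[of "k + 2" u] in auto)
    also have "\<dots> = (\<Sum>l<d. c (u ! k) (u ! (k + 1)) l
        * trace_prod J (P k) (N l # map N (drop (k + 2) u)))"
      by (simp add: tr_cochain_def trace_prod_def P_def)
    also have "\<dots> = trace_prod J (mat_mul J (P k) (R (u ! k))) (N (u ! (k + 1)) # map N (drop (k + 2) u))
       + trace_prod J (mat_mul J (mat_mul J (P k) (N (u ! k))) (R (u ! (k + 1)))) (map N (drop (k + 2) u))"
      by (rule trace_prod_merge) (use k ud in auto)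
    also have "N (u ! (k + 1)) # map N (drop (k + 2) u) = map N (drop (k + 1) u)"
      using k len Cons_nth_drop_Suc[of "k + 1" u] by (simp flip: list.map(2))
    also have "mat_mul J (P k) (N (u ! k)) = P (Suc k)" using P_Suc k by simp
    finally show ?thesis by (simp add: Y_def)
  qed
  \<comment> \<open>The cyclic face multiplies the last letter into the first and leaves
    \<open>mid\<close> untouched.\<close>
  define mid where "mid = take n (drop 1 u)"
  have u_mid: "drop 1 u = mid @ [u ! (n + 1)]" "take (n + 1) u = u ! 0 # mid"
  proof -
    show "drop 1 u = mid @ [u ! (n + 1)]"
      unfolding mid_def using len take_Suc_conv_app_nth[of n "drop 1 u"] by simp
    show "take (n + 1) u = u ! 0 # mid"
      unfolding mid_def using len by (cases u) auto
  qed
  have last: "(\<Sum>w\<in>tuples d n. (if drop 1 w = take n (drop 1 u)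
        then c (u ! (n + 1)) (u ! 0) (w ! 0) else 0) * tr_cochain w) = Y (n + 1) + \<delta> * Y 0"
  proof -
    have "set mid \<subseteq> set u" unfolding mid_def using set_take_subset set_drop_subset by fastforce
    then have "(\<Sum>w\<in>tuples d n. (if take 0 w = [] \<and> drop (0 + 1) w = mid
        then c (u ! (n + 1)) (u ! 0) (w ! 0) else 0) * tr_cochain w)
      = (\<Sum>l<d. c (u ! (n + 1)) (u ! 0) l * tr_cochain ([] @ l # mid))"
      by (intro sum_tuples_replace) (use set_u len in \<open>auto simp: mid_def\<close>)
    also have "\<dots> = (\<Sum>l<d. c (u ! (n + 1)) (u ! 0) l * trace_prod J D (N l # map N mid))"
      by (simp add: tr_cochain_def)
    also have "\<dots> = trace_prod J (mat_mul J D (R (u ! (n + 1)))) (N (u ! 0) # map N mid)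
        + trace_prod J (mat_mul J (mat_mul J D (N (u ! (n + 1)))) (R (u ! 0))) (map N mid)"
      by (rule trace_prod_merge) (use ud in auto)
    \<comment> \<open>The \<open>R\<close> of the last letter commutes with \<open>D\<close> and is
      carried by the trace to the end of the word. In the other term, treated next, the
      \<open>N\<close> of the last letter crosses \<open>D\<close> and contributes \<delta>.\<close>
    also have "trace_prod J (mat_mul J D (R (u ! (n + 1)))) (N (u ! 0) # map N mid) = Y (n + 1)"
    proof -
      have "trace_prod J (mat_mul J D (R (u ! (n + 1)))) (N (u ! 0) # map N mid)
          = mat_trace J (mat_mul J (P (n + 1)) (R (u ! (n + 1))))"
        by (simp add: commute_R ud trace_prod_move P_def u_mid(2)[simplified])
      then show ?thesis using len by (simp add: Y_def trace_prod_def)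
    qed
    also have "trace_prod J (mat_mul J (mat_mul J D (N (u ! (n + 1)))) (R (u ! 0))) (map N mid) = \<delta> * Y 0"
      using ud[of "n + 1"] u_mid(1)
      by (simp add: commute_N mat_mul_scale_left trace_prod_scale mat_mul_assoc foldl_mat_mul
          Y_def P_def trace_prod_def mat_trace_mul_commute[of J "N (u ! Suc n)"])
    finally show ?thesis by (simp add: mid_def)
  qed
  have "(\<Sum>w\<in>tuples d n. hoch_coeff c n u w * tr_cochain w)
    = (\<Sum>k\<le>n. (-1) ^ k * (\<Sum>w\<in>tuples d n. (if take k w = take k u \<and> drop (k + 1) w = drop (k + 2) u
        then c (u ! k) (u ! (k + 1)) (w ! k) else 0) * tr_cochain w))
      + (-1) ^ (n + 1) * (\<Sum>w\<in>tuples d n. (if drop 1 w = take n (drop 1 u)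
        then c (u ! (n + 1)) (u ! 0) (w ! 0) else 0) * tr_cochain w)"
    unfolding hoch_coeff_def distrib_right sum.distrib sum_distrib_right
    by (subst sum.swap) (simp only: sum_distrib_left mult.assoc)
  also have "\<dots> = (\<Sum>k\<le>n. (-1) ^ k * (Y k + Y (Suc k))) + (-1) ^ (n + 1) * (Y (n + 1) + \<delta> * Y 0)"
    unfolding last by (intro arg_cong2[where f = "(+)"] sum.cong refl) (simp add: face[simplified])
  also have "\<dots> = Y 0 * (1 - (-1) ^ n * \<delta>)"
    unfolding alternating_telescope by (simp add: algebra_simps)
  also have "\<dots> = 0" unfolding \<delta> by (simp flip: power_mult_distrib)
  finally show ?thesis .
qed

text \<open>The class is that of a single basis tensor. Its letters have zero products, also across
  the ends, so all its faces vanish. It is no boundary, because \<open>tr_cochain\<close> pairs to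
  zero with every boundary but not with this tensor.\<close>

lemma HH_nonzero_if_tr_cochain:
  assumes u: "u \<in> tuples d n" and \<delta>: "\<delta> = (-1) ^ n" and nz: "tr_cochain u \<noteq> 0"
    and zero: "\<And>i j l. i \<in> set u \<Longrightarrow> j \<in> set u \<Longrightarrow> c i j l = 0"
  shows "HH_nonzero d c n"
proof -
  define x where "x = (\<lambda>v. if v = u then 1 else 0 :: 'k)"
  have chain: "chain d n x" using u by (auto simp: chain_def x_def)
  have "hoch_coeff c m u w = 0" if n: "n = Suc m" for m w
  proof -
    have len: "length u = m + 2" using u n by (simp add: tuples_def)
    have "c (u ! i) (u ! j) l = 0" if "i < m + 2" "j < m + 2" for i j l
      using that len by (intro zero) simp_all
    then have "(if take k w = take k u \<and> drop (k + 1) w = drop (k + 2) u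
          then c (u ! k) (u ! (k + 1)) (w ! k) else 0) = 0" if "k \<le> m" for k
      using that by simp
    then show ?thesis
      unfolding hoch_coeff_def using \<open>\<And>i j l. i < m + 2 \<Longrightarrow> j < m + 2 \<Longrightarrow> c (u ! i) (u ! j) l = 0\<close> by simp
  qed
  then have "hoch_d d c (n - 1) x = (\<lambda>_. 0)" if "n \<noteq> 0"
  proof -
    have eq: "x v * hoch_coeff c (n - 1) v w = 0" for v w
      using that \<open>\<And>m w. n = Suc m \<Longrightarrow> hoch_coeff c m u w = 0\<close>[of "n - 1"] by (simp add: x_def)
    show ?thesis unfolding hoch_d_def eq by (simp add: fun_eq_iff)
  qed
  then have cyc: "x \<in> hoch_cycles d c n" using chain by (auto simp: hoch_cycles_def)
  have "x \<notin> hoch_boundaries d c n"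
  proof
    assume "x \<in> hoch_boundaries d c n"
    then obtain y where x: "x = hoch_d d c n y" by (auto simp: hoch_boundaries_def)
    have "tr_cochain u = (\<Sum>w\<in>tuples d n. x w * tr_cochain w)"
      using u by (simp add: x_def finite_tuples if_distrib[of "\<lambda>t. t * _"] cong: if_cong)
    also have "\<dots> = (\<Sum>w\<in>tuples d n. \<Sum>v\<in>tuples d (Suc n). y v * (hoch_coeff c n v w * tr_cochain w))"
      unfolding x hoch_d_def by (simp add: sum_distrib_right mult.assoc)
    also have "\<dots> = (\<Sum>v\<in>tuples d (Suc n). y v * (\<Sum>w\<in>tuples d n. hoch_coeff c n v w * tr_cochain w))"
      by (subst sum.swap) (simp add: sum_distrib_left)
    also have "\<dots> = 0" by (simp add: tr_cochain_boundary \<delta>)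
    finally show False using nz by simp
  qed
  then show ?thesis using cyc by (auto simp: HH_nonzero_def)
qed

end

section \<open>Vector spaces of functions\<close>

definition fscale :: "'k::field \<Rightarrow> ('i \<Rightarrow> 'k) \<Rightarrow> 'i \<Rightarrow> 'k" where
  "fscale s f = (\<lambda>i. s * f i)"

lemma fscale_apply [simp]: "fscale s f i = s * f i"
  by (simp add: fscale_def)

interpretation fun_vs: vector_space "fscale :: 'k::field \<Rightarrow> ('i \<Rightarrow> 'k) \<Rightarrow> 'i \<Rightarrow> 'k"
  by unfold_locales (auto simp: fun_eq_iff algebra_simps)

definition unit_fun :: "'i \<Rightarrow> 'i \<Rightarrow> 'k::field" where
  "unit_fun j = (\<lambda>i. if i = j then 1 else 0)"

lemma unit_fun_nonzero: "unit_fun j \<noteq> (0 :: 'i \<Rightarrow> 'k::field)"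
  by (auto simp: unit_fun_def fun_eq_iff)

lemma sum_fun_apply: "(\<Sum>i\<in>A. f i) x = (\<Sum>i\<in>A. f i x :: 'k::comm_monoid_add)"
  by (induction A rule: infinite_finite_induct) auto

lemma sum_unit_fun:
  assumes "finite S" "\<And>i. i \<notin> S \<Longrightarrow> x i = 0"
  shows "(\<Sum>i\<in>S. fscale (x i) (unit_fun i)) = x"
proof
  fix j
  show "(\<Sum>i\<in>S. fscale (x i) (unit_fun i)) j = x j"
    using assms by (cases "j \<in> S") (auto simp: sum_fun_apply unit_fun_def if_distrib[of "\<lambda>t. _ * t"] cong: if_cong)
qed

lemma independent_supported:
  assumes S: "finite S" and ind: "fun_vs.independent B"
    and supp: "\<And>f i. f \<in> B \<Longrightarrow> i \<notin> S \<Longrightarrow> f i = 0"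
  shows "finite B" "card B \<le> card S"
proof -
  have "B \<subseteq> fun_vs.span (unit_fun ` S)"
  proof
    fix f assume "f \<in> B"
    then have "f = (\<Sum>i\<in>S. fscale (f i) (unit_fun i))"
      using sum_unit_fun[OF S, of f] supp by auto
    also have "\<dots> \<in> fun_vs.span (unit_fun ` S)"
      by (intro fun_vs.span_sum fun_vs.span_scale fun_vs.span_base imageI)
    finally show "f \<in> fun_vs.span (unit_fun ` S)" .
  qed
  from fun_vs.independent_span_bound[OF _ ind this] S
  show "finite B" "card B \<le> card S" using card_image_le[of S unit_fun] by (auto intro: order_trans)
qed

text \<open>A basis of \<open>U\<close> together with \<open>v\<close> is independent, so a linear
  form can be prescribed on it; \<open>\<eta>\<close> lists the values of that form on the unit
  vectors. It serves to pass to the dual module in \<open>simple_right_submodule\<close>.\<close>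

lemma separating_functional:
  fixes U :: "('i \<Rightarrow> 'k::field) set"
  assumes S: "finite S" and U: "fun_vs.subspace U" and supp: "\<And>f i. f \<in> U \<Longrightarrow> i \<notin> S \<Longrightarrow> f i = 0"
    and v: "v \<notin> U" "\<And>i. i \<notin> S \<Longrightarrow> v i = 0"
  obtains \<eta> where "\<And>x. x \<in> U \<Longrightarrow> (\<Sum>i\<in>S. \<eta> i * x i) = 0" "(\<Sum>i\<in>S. \<eta> i * v i) = 1"
proof -
  interpret fun_functional: vector_space_pair "fscale :: 'k \<Rightarrow> ('i \<Rightarrow> 'k) \<Rightarrow> 'i \<Rightarrow> 'k"
    "(*) :: 'k \<Rightarrow> 'k \<Rightarrow> 'k"
    by unfold_locales (auto simp: algebra_simps)
  obtain B where B: "B \<subseteq> U" "fun_vs.independent B" "U \<subseteq> fun_vs.span B"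
    using fun_vs.maximal_independent_subset by blast
  have span: "fun_vs.span B = U" using B(1,3) U fun_vs.span_minimal by blast
  then have ind: "fun_vs.independent (insert v B)"
    using v(1) B(2) by (intro fun_vs.independent_insertI) auto
  obtain f where f: "Vector_Spaces.linear fscale (*) f" "\<And>x. x \<in> insert v B \<Longrightarrow> f x = (if x = v then 1 else 0)"
    using fun_functional.linear_independent_extend[OF ind, of "\<lambda>x. if x = v then 1 else 0"] by metis
  interpret f: Vector_Spaces.linear fscale "(*)" f by (rule f(1))
  have val: "f x = (\<Sum>i\<in>S. f (unit_fun i) * x i)" if "\<And>i. i \<notin> S \<Longrightarrow> x i = 0" for x
  proof -
    have "f x = f (\<Sum>i\<in>S. fscale (x i) (unit_fun i))" using sum_unit_fun[OF S, of x] that by simp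
    then show ?thesis by (simp add: f.sum f.scale mult.commute)
  qed
  have "f x = 0" if "x \<in> U" for x
  proof -
    have "f x = 0" if "x \<in> fun_vs.span B" for x using that
      by (rule f.eq_0_on_span[rotated]) (use f(2) v(1) B(1) in auto)
    with that span show ?thesis by simp
  qed
  then show thesis using that[of "\<lambda>i. f (unit_fun i)"] val supp v(2) f(2)[of v] by (metis insertI1)
qed

lemma vecs_0 [simp]: "0 \<in> vecs n"
  and vecs_add: "x \<in> vecs n \<Longrightarrow> y \<in> vecs n \<Longrightarrow> x + y \<in> vecs n"
  and vecs_diff: "x \<in> vecs n \<Longrightarrow> y \<in> vecs n \<Longrightarrow> x - y \<in> vecs n"
  and vecs_scale: "x \<in> vecs n \<Longrightarrow> fscale s x \<in> vecs n"
  and vecs_unit_fun: "i < n \<Longrightarrow> unit_fun i \<in> vecs n"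
  by (auto simp: vecs_def unit_fun_def)

lemma vecs_sum: "(\<And>i. i \<in> A \<Longrightarrow> f i \<in> vecs n) \<Longrightarrow> (\<Sum>i\<in>A. f i) \<in> vecs n"
  by (auto simp: vecs_def sum_fun_apply)

lemma vecs_expand: "x \<in> vecs n \<Longrightarrow> x = (\<Sum>i<n. fscale (x i) (unit_fun i))"
  by (rule sum_unit_fun[symmetric]) (auto simp: vecs_def)

lemmas vecs_intros = vecs_add vecs_diff vecs_scale vecs_unit_fun vecs_sum

text \<open>Algebraic closedness enters here, through a root of the characteristic
  polynomial.\<close>

lemma eigenvector_exists:
  fixes F :: "nat \<Rightarrow> nat \<Rightarrow> 'k::field"
  assumes "alg_closed TYPE('k)" "n > 0"
  obtains s v where "v \<in> vecs n" "v \<noteq> 0" "\<And>i. i < n \<Longrightarrow> (\<Sum>j<n. F i j * v j) = s * v i"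
proof -
  define M where "M = mat n n (\<lambda>(i, j). F i j)"
  have M: "M \<in> carrier_mat n n" by (simp add: M_def)
  from degree_monic_char_poly[OF M] assms obtain s where "poly (char_poly M) s = 0"
    by (auto simp: alg_closed_def)
  then obtain v where v: "v \<in> carrier_vec n" "v \<noteq> 0\<^sub>v n" "M *\<^sub>v v = s \<cdot>\<^sub>v v"
    using eigenvalue_root_char_poly[OF M] M by (auto simp: eigenvalue_def eigenvector_def)
  define w where "w = (\<lambda>i. if i < n then v $ i else 0)"
  have "w \<noteq> 0" using v(1,2) by (auto simp: w_def fun_eq_iff vec_eq_iff split: if_splits)
  moreover have "(\<Sum>j<n. F i j * w j) = s * w i" if "i < n" for i
  proof -
    have "(M *\<^sub>v v) $ i = s * v $ i" using v that by simp
    then show ?thesis using that v(1) by (simp add: M_def w_def scalar_prod_def lessThan_atLeast0)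
  qed
  ultimately show thesis using that[of w s] by (auto simp: w_def vecs_def)
qed

text \<open>Dependence is available for sets of vectors, not for families. A family with a
  repetition is therefore treated apart, by subtracting two equal members.\<close>

lemma linear_relation:
  fixes v :: "nat \<Rightarrow> nat \<Rightarrow> 'k::field"
  assumes v: "\<And>k. k < Suc d \<Longrightarrow> v k \<in> vecs d"
  obtains t k where "k < Suc d" "t k \<noteq> 0" "(\<Sum>k<Suc d. fscale (t k) (v k)) = 0"
proof (cases "inj_on v {..<Suc d}")
  case False
  then obtain k l where kl: "k < Suc d" "l < Suc d" "k \<noteq> l" "v k = v l" by (auto simp: inj_on_def)
  define t :: "nat \<Rightarrow> 'k" where "t p = (if p = k then 1 else 0) - (if p = l then 1 else 0)" for p
  have "(\<Sum>p<Suc d. t p * v p i) = v k i - v l i" for i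
  proof -
    have "(\<Sum>p<Suc d. t p * v p i) = (\<Sum>p<Suc d. if p = k then v p i else 0) - (\<Sum>p<Suc d. if p = l then v p i else 0)"
      unfolding t_def sum_subtractf[symmetric] by (intro sum.cong) auto
    also have "\<dots> = v k i - v l i" using kl(1,2) by (simp only: sum.delta finite_lessThan) simp
    finally show ?thesis .
  qed
  then have "(\<Sum>p<Suc d. fscale (t p) (v p)) i = 0" for i
    using kl(4) by (simp only: sum_fun_apply fscale_apply) simp
  then have "(\<Sum>p<Suc d. fscale (t p) (v p)) = 0" by (intro ext) (simp only: zero_fun_apply)
  then show thesis using kl(1,3) by (intro that[of k t]) (auto simp: t_def)
next
  case True
  define B where "B = v ` {..<Suc d}"
  have card: "card B = Suc d" using card_image[OF True] by (simp add: B_def)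
  have supp: "f i = 0" if "f \<in> B" "i \<notin> {..<d}" for f i using that v by (auto simp: B_def vecs_def)
  have "fun_vs.dependent B"
    using independent_supported(2)[of "{..<d}" B] supp card by force
  then obtain u w where u: "w \<in> B" "u w \<noteq> 0" "(\<Sum>x\<in>B. fscale (u x) x) = 0"
    using fun_vs.dependent_finite[of B] by (auto simp: B_def)
  obtain k where k: "k < Suc d" "w = v k" using u(1) by (auto simp: B_def)
  have "(\<Sum>k<Suc d. fscale (u (v k)) (v k)) = 0"
    using u(3) sum.reindex[OF True, of "\<lambda>x. fscale (u x) x"] by (simp only: B_def o_def)
  then show thesis using k u(2) by (intro that[of k "\<lambda>k. u (v k)"]) auto
qed

section \<open>Simple modules over a finite dimensional algebra\<close>

locale unital_algebra =
  fixes d :: nat and c :: "nat \<Rightarrow> nat \<Rightarrow> nat \<Rightarrow> 'k::field"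
  assumes fd_algebra: "fd_algebra d c"
begin

abbreviation A where "A \<equiv> vecs d :: (nat \<Rightarrow> 'k) set"
abbreviation mul (infixl "\<cdot>" 70) where "x \<cdot> y \<equiv> amul c d x y"

lemma mul_closed [simp]: "x \<cdot> y \<in> A"
  by (simp add: amul_def vecs_def)

lemma mul_add_left: "(x + y) \<cdot> z = x \<cdot> z + y \<cdot> z"
  by (rule ext) (simp add: amul_def distrib_right sum.distrib)

lemma mul_add_right: "z \<cdot> (x + y) = z \<cdot> x + z \<cdot> y"
  by (rule ext) (simp add: amul_def distrib_left distrib_right sum.distrib)

lemma mul_scale_left: "fscale s x \<cdot> z = fscale s (x \<cdot> z)"
  by (rule ext) (simp add: amul_def sum_distrib_left mult.assoc)

lemma mul_scale_right: "z \<cdot> fscale s x = fscale s (z \<cdot> x)"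
  by (rule ext) (simp add: amul_def sum_distrib_left mult.assoc mult.left_commute)

lemma mul_zero_left [simp]: "0 \<cdot> x = 0"
  by (rule ext) (simp add: amul_def)

lemma mul_zero_right [simp]: "x \<cdot> 0 = 0"
  by (rule ext) (simp add: amul_def)

lemma mul_diff_left: "(x - y) \<cdot> z = x \<cdot> z - y \<cdot> z"
  using mul_add_left[of "x - y" y z] by (simp add: eq_diff_eq)

lemma mul_diff_right: "z \<cdot> (x - y) = z \<cdot> x - z \<cdot> y"
  using mul_add_right[of z "x - y" y] by (simp add: eq_diff_eq)

lemma mul_sum_left: "(\<Sum>i\<in>S. f i) \<cdot> z = (\<Sum>i\<in>S. f i \<cdot> z)"
  using sum_comp_morphism[of "\<lambda>x. x \<cdot> z" f S] by (simp add: mul_add_left o_def)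

lemma mul_sum_right: "z \<cdot> (\<Sum>i\<in>S. f i) = (\<Sum>i\<in>S. z \<cdot> f i)"
  using sum_comp_morphism[of "\<lambda>x. z \<cdot> x" f S] by (simp add: mul_add_right o_def)

lemma mul_unit_unit:
  assumes "i < d" "j < d"
  shows "unit_fun i \<cdot> unit_fun j = (\<lambda>l. if l < d then c i j l else 0)"
proof -
  have "(\<Sum>p<d. \<Sum>q<d. unit_fun i p * unit_fun j q * c p q l) = c i j l" for l
  proof -
    have "(\<Sum>p<d. \<Sum>q<d. unit_fun i p * unit_fun j q * c p q l)
        = (\<Sum>p<d. if p = i then \<Sum>q<d. if q = j then c p q l else 0 else 0)"
      by (intro sum.cong refl) (auto simp: unit_fun_def if_distrib[of "\<lambda>t. t * _"] cong: if_cong)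
    also have "\<dots> = c i j l" using assms by simp
    finally show ?thesis .
  qed
  then show ?thesis by (simp add: amul_def fun_eq_iff)
qed

lemma mul_unit_right_coeff:
  assumes "i < d" "l < d" "x \<in> A"
  shows "(x \<cdot> unit_fun i) l = (\<Sum>m<d. c m i l * x m)"
proof -
  have "(x \<cdot> unit_fun i) l = ((\<Sum>m<d. fscale (x m) (unit_fun m)) \<cdot> unit_fun i) l"
    by (simp only: vecs_expand[OF assms(3), symmetric])
  then show ?thesis
    using assms by (simp add: mul_sum_left mul_scale_left sum_fun_apply mul_unit_unit mult.commute)
qed

lemma mul_unit_left_coeff:
  assumes "i < d" "l < d" "x \<in> A"
  shows "(unit_fun i \<cdot> x) l = (\<Sum>m<d. c i m l * x m)"
proof -
  have "(unit_fun i \<cdot> x) l = (unit_fun i \<cdot> (\<Sum>m<d. fscale (x m) (unit_fun m))) l"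
    by (simp only: vecs_expand[OF assms(3), symmetric])
  then show ?thesis
    using assms by (simp add: mul_sum_right mul_scale_right sum_fun_apply mul_unit_unit mult.commute)
qed

lemma mul_assoc_unit:
  assumes "i < d" "j < d" "l < d"
  shows "unit_fun i \<cdot> unit_fun j \<cdot> unit_fun l = unit_fun i \<cdot> (unit_fun j \<cdot> unit_fun l)"
proof -
  have e: "unit_fun i \<cdot> unit_fun j = (\<Sum>p<d. fscale (c i j p) (unit_fun p))" if "i < d" "j < d" for i j
    using vecs_expand[OF mul_closed, of "unit_fun i" "unit_fun j"] that by (simp add: mul_unit_unit)
  have "unit_fun i \<cdot> unit_fun j \<cdot> unit_fun l = (\<Sum>p<d. fscale (c i j p) (unit_fun p)) \<cdot> unit_fun l"
    "unit_fun i \<cdot> (unit_fun j \<cdot> unit_fun l) = unit_fun i \<cdot> (\<Sum>p<d. fscale (c j l p) (unit_fun p))"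
    by (simp_all only: e assms)
  moreover have "(\<Sum>p<d. c i j p * c p l m) = (\<Sum>p<d. c j l p * c i p m)" if "m < d" for m
    using fd_algebra assms that by (auto simp: fd_algebra_def)
  ultimately have "(unit_fun i \<cdot> unit_fun j \<cdot> unit_fun l) m = (unit_fun i \<cdot> (unit_fun j \<cdot> unit_fun l)) m" for m
    using assms by (cases "m < d")
      (auto simp: mul_sum_left mul_sum_right mul_scale_left mul_scale_right sum_fun_apply mul_unit_unit)
  then show ?thesis by (rule ext)
qed

lemma mul_assoc:
  assumes "x \<in> A" "y \<in> A" "z \<in> A"
  shows "x \<cdot> y \<cdot> z = x \<cdot> (y \<cdot> z)"
proof -
  have "(\<Sum>i<d. fscale (x i) (unit_fun i)) \<cdot> (\<Sum>j<d. fscale (y j) (unit_fun j))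
      \<cdot> (\<Sum>l<d. fscale (z l) (unit_fun l))
    = (\<Sum>i<d. fscale (x i) (unit_fun i)) \<cdot> ((\<Sum>j<d. fscale (y j) (unit_fun j))
      \<cdot> (\<Sum>l<d. fscale (z l) (unit_fun l)))"
    by (simp add: mul_sum_left mul_sum_right mul_scale_left mul_scale_right mul_assoc_unit)
  then show ?thesis by (simp only: vecs_expand[symmetric] assms)
qed

lemma unit_exists: "\<exists>e\<in>A. \<forall>x\<in>A. e \<cdot> x = x \<and> x \<cdot> e = x"
proof -
  obtain e where e: "e \<in> A" "\<And>i m. i < d \<Longrightarrow> m < d \<Longrightarrow> (\<Sum>p<d. e p * c p i m) = (if i = m then 1 else 0)"
    "\<And>i m. i < d \<Longrightarrow> m < d \<Longrightarrow> (\<Sum>p<d. e p * c i p m) = (if i = m then 1 else 0)"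
    using fd_algebra by (auto simp: fd_algebra_def)
  have ee: "e = (\<Sum>p<d. fscale (e p) (unit_fun p))" using vecs_expand e(1) .
  have uf: "unit_fun i m = (if i = m then 1 else 0 :: 'k)" for i m :: nat
    by (simp add: unit_fun_def)
  have l: "e \<cdot> unit_fun i = unit_fun i" if "i < d" for i
  proof
    fix m
    have "(e \<cdot> unit_fun i) m = ((\<Sum>p<d. fscale (e p) (unit_fun p)) \<cdot> unit_fun i) m"
      by (rule arg_cong[where f = "\<lambda>t. (t \<cdot> unit_fun i) m", OF ee])
    also have "\<dots> = unit_fun i m"
      using that by (cases "m < d") (auto simp: mul_sum_left mul_scale_left sum_fun_apply mul_unit_unit e(2) uf)
    finally show "(e \<cdot> unit_fun i) m = unit_fun i m" .
  qed
  have r: "unit_fun i \<cdot> e = unit_fun i" if "i < d" for i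
  proof
    fix m
    have "(unit_fun i \<cdot> e) m = (unit_fun i \<cdot> (\<Sum>p<d. fscale (e p) (unit_fun p))) m"
      by (rule arg_cong[where f = "\<lambda>t. (unit_fun i \<cdot> t) m", OF ee])
    also have "\<dots> = unit_fun i m"
      using that by (cases "m < d") (auto simp: mul_sum_right mul_scale_right sum_fun_apply mul_unit_unit e(3) uf)
    finally show "(unit_fun i \<cdot> e) m = unit_fun i m" .
  qed
  have "e \<cdot> x = x" "x \<cdot> e = x" if "x \<in> A" for x
  proof -
    have "e \<cdot> (\<Sum>p<d. fscale (x p) (unit_fun p)) = (\<Sum>p<d. fscale (x p) (unit_fun p))"
      "(\<Sum>p<d. fscale (x p) (unit_fun p)) \<cdot> e = (\<Sum>p<d. fscale (x p) (unit_fun p))"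
      by (simp_all add: mul_sum_right mul_scale_right l mul_sum_left mul_scale_left r)
    then show "e \<cdot> x = x" "x \<cdot> e = x" by (simp_all only: vecs_expand[OF that, symmetric])
  qed
  with e(1) show ?thesis by blast
qed

definition unit_elt :: "nat \<Rightarrow> 'k" where
  "unit_elt = (SOME e. e \<in> A \<and> (\<forall>x\<in>A. e \<cdot> x = x \<and> x \<cdot> e = x))"

lemma unit_elt [simp]: "unit_elt \<in> A"
  and mul_unit_left: "x \<in> A \<Longrightarrow> unit_elt \<cdot> x = x"
  and mul_unit_right: "x \<in> A \<Longrightarrow> x \<cdot> unit_elt = x"
  using someI_ex[of "\<lambda>e. e \<in> A \<and> (\<forall>x\<in>A. e \<cdot> x = x \<and> x \<cdot> e = x)"] unit_exists
  unfolding unit_elt_def[symmetric] by blast+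

section \<open>Modules as matrix representations\<close>

definition rep :: "nat \<Rightarrow> ((nat \<Rightarrow> 'k) \<Rightarrow> nat \<Rightarrow> nat \<Rightarrow> 'k) \<Rightarrow> bool" where
  "rep n \<rho> \<longleftrightarrow> (\<forall>r<n. \<forall>q<n.
     (\<forall>a\<in>A. \<forall>b\<in>A. \<rho> (a + b) r q = \<rho> a r q + \<rho> b r q) \<and>
     (\<forall>s. \<forall>a\<in>A. \<rho> (fscale s a) r q = s * \<rho> a r q) \<and>
     (\<forall>a\<in>A. \<forall>b\<in>A. \<rho> (a \<cdot> b) r q = (\<Sum>p<n. \<rho> a r p * \<rho> b p q)) \<and>
     \<rho> unit_elt r q = (if r = q then 1 else 0))"

definition mv :: "nat \<Rightarrow> ((nat \<Rightarrow> 'k) \<Rightarrow> nat \<Rightarrow> nat \<Rightarrow> 'k) \<Rightarrow> (nat \<Rightarrow> 'k) \<Rightarrow> (nat \<Rightarrow> 'k) \<Rightarrow> nat \<Rightarrow> 'k" where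
  "mv n \<rho> a x = (\<lambda>r. if r < n then \<Sum>q<n. \<rho> a r q * x q else 0)"

definition simple :: "nat \<Rightarrow> ((nat \<Rightarrow> 'k) \<Rightarrow> nat \<Rightarrow> nat \<Rightarrow> 'k) \<Rightarrow> bool" where
  "simple n \<rho> \<longleftrightarrow> n > 0 \<and> rep n \<rho> \<and> (\<forall>x\<in>vecs n. x \<noteq> 0 \<longrightarrow> (\<forall>y\<in>vecs n. \<exists>a\<in>A. mv n \<rho> a x = y))"

lemma mv_closed [simp]: "mv n \<rho> a x \<in> vecs n"
  by (simp add: mv_def vecs_def)

lemma mv_add_right: "mv n \<rho> a (x + y) = mv n \<rho> a x + mv n \<rho> a y"
  and mv_scale_right: "mv n \<rho> a (fscale s x) = fscale s (mv n \<rho> a x)"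
  and mv_zero_right [simp]: "mv n \<rho> a 0 = 0"
  by (auto simp: mv_def fun_eq_iff algebra_simps sum.distrib sum_subtractf sum_distrib_left)

lemma mv_unit_fun: "q < n \<Longrightarrow> r < n \<Longrightarrow> mv n \<rho> a (unit_fun q) r = \<rho> a r q"
  by (simp add: mv_def unit_fun_def if_distrib[of "\<lambda>t. _ * t"] cong: if_cong)

context
  fixes n \<rho> assumes rep: "rep n \<rho>"
begin

lemma mv_add_left: "a \<in> A \<Longrightarrow> b \<in> A \<Longrightarrow> mv n \<rho> (a + b) x = mv n \<rho> a x + mv n \<rho> b x"
  using rep by (auto simp: rep_def mv_def fun_eq_iff algebra_simps sum.distrib)

lemma mv_scale_left: "a \<in> A \<Longrightarrow> mv n \<rho> (fscale s a) x = fscale s (mv n \<rho> a x)"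
  using rep by (auto simp: rep_def mv_def fun_eq_iff algebra_simps sum_distrib_left)

lemma mv_zero_left [simp]: "mv n \<rho> 0 x = 0"
  using mv_scale_left[of 0 0 x] by simp

lemma mv_diff_left: "a \<in> A \<Longrightarrow> b \<in> A \<Longrightarrow> mv n \<rho> (a - b) x = mv n \<rho> a x - mv n \<rho> b x"
  using mv_add_left[of "a - b" b] by (simp add: vecs_diff)

lemma mv_sum_left: "(\<And>i. i \<in> S \<Longrightarrow> f i \<in> A) \<Longrightarrow> mv n \<rho> (\<Sum>i\<in>S. f i) x = (\<Sum>i\<in>S. mv n \<rho> (f i) x)"
  by (induction S rule: infinite_finite_induct) (auto simp: mv_add_left vecs_sum)

lemma mv_mul: 
  assumes "a \<in> A" "b \<in> A"
  shows "mv n \<rho> (a \<cdot> b) x = mv n \<rho> a (mv n \<rho> b x)"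
proof
  fix r
  show "mv n \<rho> (a \<cdot> b) x r = mv n \<rho> a (mv n \<rho> b x) r"
  proof (cases "r < n")
    case True
    have "mv n \<rho> (a \<cdot> b) x r = (\<Sum>q<n. \<Sum>p<n. \<rho> a r p * \<rho> b p q * x q)"
      using True rep assms by (simp add: mv_def rep_def sum_distrib_right)
    also have "\<dots> = (\<Sum>p<n. \<Sum>q<n. \<rho> a r p * \<rho> b p q * x q)" by (rule sum.swap)
    also have "\<dots> = mv n \<rho> a (mv n \<rho> b x) r"
      using True by (simp add: mv_def sum_distrib_left mult.assoc)
    finally show ?thesis .
  qed (simp add: mv_def)
qed

lemma mv_unit: "x \<in> vecs n \<Longrightarrow> mv n \<rho> unit_elt x = x"
  using rep by (auto simp: rep_def mv_def fun_eq_iff vecs_def if_distrib[of "\<lambda>t. t * _"] cong: if_cong)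

end

lemma simple_rep: "simple n \<rho> \<Longrightarrow> rep n \<rho>"
  by (simp add: simple_def)

lemma simple_transitive:
  assumes "simple n \<rho>" "x \<in> vecs n" "x \<noteq> 0" "y \<in> vecs n"
  obtains a where "a \<in> A" "mv n \<rho> a x = y"
  using assms unfolding simple_def by blast

section \<open>Homomorphisms, Schur's lemma and matrix coefficients\<close>

definition hom :: "nat \<Rightarrow> ((nat \<Rightarrow> 'k) \<Rightarrow> nat \<Rightarrow> nat \<Rightarrow> 'k) \<Rightarrow> nat \<Rightarrow> ((nat \<Rightarrow> 'k) \<Rightarrow> nat \<Rightarrow> nat \<Rightarrow> 'k)
    \<Rightarrow> ((nat \<Rightarrow> 'k) \<Rightarrow> (nat \<Rightarrow> 'k)) \<Rightarrow> bool" where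
  "hom n \<rho> n' \<rho>' F \<longleftrightarrow> (\<forall>x\<in>vecs n. F x \<in> vecs n') \<and>
     (\<forall>x\<in>vecs n. \<forall>y\<in>vecs n. F (x + y) = F x + F y) \<and>
     (\<forall>s. \<forall>x\<in>vecs n. F (fscale s x) = fscale s (F x)) \<and>
     (\<forall>a\<in>A. \<forall>x\<in>vecs n. F (mv n \<rho> a x) = mv n' \<rho>' a (F x))"

text \<open>Between simple modules a nonzero homomorphism is an isomorphism, so for them this is
  isomorphism.\<close>

definition similar :: "nat \<Rightarrow> ((nat \<Rightarrow> 'k) \<Rightarrow> nat \<Rightarrow> nat \<Rightarrow> 'k) \<Rightarrow> nat \<Rightarrow> ((nat \<Rightarrow> 'k) \<Rightarrow> nat \<Rightarrow> nat \<Rightarrow> 'k) \<Rightarrow> bool" where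
  "similar n \<rho> n' \<rho>' \<longleftrightarrow> (\<exists>F. hom n \<rho> n' \<rho>' F \<and> (\<exists>x\<in>vecs n. F x \<noteq> 0))"

lemma hom_zero: "hom n \<rho> n' \<rho>' F \<Longrightarrow> F 0 = 0"
  unfolding hom_def by (metis fun_vs.scale_zero_left vecs_0)

lemma hom_sum:
  assumes "hom n \<rho> n' \<rho>' F" "\<And>i. i \<in> S \<Longrightarrow> f i \<in> vecs n"
  shows "F (\<Sum>i\<in>S. f i) = (\<Sum>i\<in>S. F (f i))"
  using assms(2)
proof (induction S rule: infinite_finite_induct)
  case (insert x S)
  have "F (\<Sum>i\<in>insert x S. f i) = F (f x + (\<Sum>i\<in>S. f i))"
    by (simp only: sum.insert[OF insert.hyps])
  also have "\<dots> = F (f x) + F (\<Sum>i\<in>S. f i)"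
    using assms(1) insert.prems by (simp add: hom_def vecs_sum)
  also have "F (\<Sum>i\<in>S. f i) = (\<Sum>i\<in>S. F (f i))"
    using insert.prems by (intro insert.IH) simp
  also have "F (f x) + (\<Sum>i\<in>S. F (f i)) = (\<Sum>i\<in>insert x S. F (f i))"
    by (simp only: sum.insert[OF insert.hyps])
  finally show ?case .
qed (use hom_zero[OF assms(1)] in auto)

lemma hom_expand:
  assumes F: "hom n \<rho> n' \<rho>' F" and x: "x \<in> vecs n"
  shows "F x = (\<Sum>q<n. fscale (x q) (F (unit_fun q)))"
proof -
  have "F x = F (\<Sum>q<n. fscale (x q) (unit_fun q))" using vecs_expand[OF x] by simp
  also have "\<dots> = (\<Sum>q<n. F (fscale (x q) (unit_fun q)))"
    by (rule hom_sum[OF F]) (simp add: vecs_intros)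
  finally show ?thesis using F by (simp add: hom_def vecs_unit_fun)
qed

text \<open>An eigenvector of \<open>F\<close> generates the module, and on everything it generates
  \<open>F\<close> is multiplication by the eigenvalue.\<close>

lemma schur_scalar:
  assumes k: "alg_closed TYPE('k)" and simple: "simple n \<rho>" and F: "hom n \<rho> n \<rho> F"
  obtains s where "\<And>x. x \<in> vecs n \<Longrightarrow> F x = fscale s x"
proof -
  obtain s v where v: "v \<in> vecs n" "v \<noteq> 0"
      "\<And>i. i < n \<Longrightarrow> (\<Sum>j<n. F (unit_fun j) i * v j) = s * v i"
  proof -
    have "n > 0" using simple by (simp add: simple_def)
    then show ?thesis by (rule eigenvector_exists[OF k, of n "\<lambda>i j. F (unit_fun j) i"]) (rule that)
  qed
  have Fv: "F v = fscale s v"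
  proof
    fix i
    show "F v i = fscale s v i"
    proof (cases "i < n")
      case True
      then show ?thesis using v(3)[OF True] hom_expand[OF F v(1)] by (simp add: sum_fun_apply mult.commute)
    next
      case False
      moreover have "F v \<in> vecs n" using F v(1) by (simp add: hom_def)
      ultimately show ?thesis using v(1) by (simp add: vecs_def)
    qed
  qed
  have "F x = fscale s x" if x: "x \<in> vecs n" for x
  proof -
    obtain a where a: "a \<in> A" "mv n \<rho> a v = x" using simple_transitive[OF simple v(1,2) x] .
    have "F (mv n \<rho> a v) = mv n \<rho> a (F v)" using F a(1) v(1) by (simp add: hom_def)
    then show ?thesis using a(2) by (simp add: Fv mv_scale_right)
  qed
  then show thesis using that by blast
qed

lemma hom_simple_inj:
  assumes V: "simple n \<rho>" and F: "hom n \<rho> n' \<rho>' F" and x0: "x0 \<in> vecs n" "F x0 \<noteq> 0"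
    and x: "x \<in> vecs n" "F x = 0"
  shows "x = 0"
proof (rule ccontr)
  assume "x \<noteq> 0"
  then obtain a where a: "a \<in> A" "mv n \<rho> a x = x0" using simple_transitive[OF V x(1) _ x0(1)] by blast
  have "F (mv n \<rho> a x) = mv n' \<rho>' a (F x)" using F a(1) x(1) by (simp add: hom_def)
  then show False using a(2) x(2) x0(2) by simp
qed

text \<open>A nonzero homomorphism is injective since its source is simple and surjective since its
  target is simple; the inverse map is again a homomorphism.\<close>

lemma similar_sym:
  assumes V: "simple n \<rho>" and V': "simple n' \<rho>'" and sim: "similar n \<rho> n' \<rho>'"
  shows "similar n' \<rho>' n \<rho>"
proof -
  obtain F x0 where F: "hom n \<rho> n' \<rho>' F" and x0: "x0 \<in> vecs n" "F x0 \<noteq> 0"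
    using sim by (auto simp: similar_def)
  have closed: "F x \<in> vecs n'" if "x \<in> vecs n" for x using F that by (simp add: hom_def)
  have equiv: "F (mv n \<rho> a x) = mv n' \<rho>' a (F x)" if "a \<in> A" "x \<in> vecs n" for a x
    using F that by (simp add: hom_def)
  have add: "F (x + y) = F x + F y" if "x \<in> vecs n" "y \<in> vecs n" for x y
    using F that by (simp add: hom_def)
  have scale: "F (fscale s x) = fscale s (F x)" if "x \<in> vecs n" for s x
    using F that by (simp add: hom_def)
  have inj0: "x = 0" if "x \<in> vecs n" "F x = 0" for x
    by (rule hom_simple_inj[OF V F x0 that])
  have inj: "inj_on F (vecs n)"
  proof (rule inj_onI)
    fix x y assume xy: "x \<in> vecs n" "y \<in> vecs n" "F x = F y"
    have "F (x - y + y) = F (x - y) + F y" by (intro add vecs_diff xy)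
    then have "F (x - y) = 0" using xy(3) by simp
    then have "x - y = 0" by (rule inj0[OF vecs_diff[OF xy(1,2)]])
    then show "x = y" by simp
  qed
  have surj: "y \<in> F ` vecs n" if y: "y \<in> vecs n'" for y
  proof -
    obtain a where "a \<in> A" "mv n' \<rho>' a (F x0) = y"
      using simple_transitive[OF V' closed[OF x0(1)] x0(2) y] .
    then have "F (mv n \<rho> a x0) = y" using equiv x0(1) by simp
    then show ?thesis by auto
  qed
  define G where "G = inv_into (vecs n) F"
  have G: "G y \<in> vecs n" "F (G y) = y" if "y \<in> vecs n'" for y
    using surj[OF that] by (auto simp: G_def inv_into_into f_inv_into_f)
  have G_eq: "G y = x" if "x \<in> vecs n" "F x = y" for x y
    using that inj by (auto simp: G_def)
  have "G (y + z) = G y + G z" "G (fscale s y) = fscale s (G y)" if "y \<in> vecs n'" "z \<in> vecs n'" for y z s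
    using G that by (auto intro!: G_eq simp: vecs_add vecs_scale add scale)
  moreover have "G (mv n' \<rho>' a y) = mv n \<rho> a (G y)" if "a \<in> A" "y \<in> vecs n'" for a y
    using G that by (intro G_eq) (simp_all add: equiv)
  ultimately have "hom n' \<rho>' n \<rho> G" using G by (simp add: hom_def)
  moreover have "G (F x0) \<noteq> 0" using G_eq[OF x0(1) refl] x0(2) hom_zero[OF F] by auto
  ultimately show ?thesis using closed[OF x0(1)] by (auto simp: similar_def)
qed

text \<open>A shortest nonzero relation between the functionals \<open>a \<mapsto> (a \<cdot> x)\<^sub>q\<close> has all its vectors
  determined by any one of them, through homomorphisms which by Schur's lemma are zero or scalar.
  So it is a linear form vanishing on a whole simple module.\<close>

lemma matrix_coeffs_independent:
  fixes L :: nat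
  assumes k: "alg_closed TYPE('k)"
    and simple: "\<And>k. k < L \<Longrightarrow> simple (n k) (\<rho> k)"
    and nonsim: "\<And>k l. k < L \<Longrightarrow> l < L \<Longrightarrow> k \<noteq> l \<Longrightarrow> \<not> similar (n k) (\<rho> k) (n l) (\<rho> l)"
    and g: "\<And>k q. k < L \<Longrightarrow> q < n k \<Longrightarrow> g k q \<in> vecs (n k)"
    and rel: "\<And>a. a \<in> A \<Longrightarrow> (\<Sum>k<L. \<Sum>q<n k. mv (n k) (\<rho> k) a (g k q) q) = 0"
    and kq: "k < L" "q < n k"
  shows "g k q = 0"
proof -
  define S where "S = Sigma {..<L} (\<lambda>k. {..<n k})"
  define act where "act a x = (\<lambda>(k, q). mv (n k) (\<rho> k) a (x (k, q)))" for a and x :: "nat \<times> nat \<Rightarrow> nat \<Rightarrow> 'k"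
  define K where "K = {x. (\<forall>(k, q)\<in>S. x (k, q) \<in> vecs (n k)) \<and>
      (\<forall>a\<in>A. (\<Sum>(k, q)\<in>S. act a x (k, q) q) = 0)}"
  define supp where "supp x = {j \<in> S. x j \<noteq> (0 :: nat \<Rightarrow> 'k)}" for x
  have fin: "finite S" by (simp add: S_def)
  have rp: "rep (n k) (\<rho> k)" if "k < L" for k using simple[OF that] by (rule simple_rep)
  have act_mul: "act (a \<cdot> b) x j = act a (act b x) j" if "a \<in> A" "b \<in> A" "j \<in> S" for a b x j
    using that by (auto simp: act_def S_def mv_mul[OF rp])
  \<comment> \<open>The relation for \<open>act a x\<close> at \<open>b\<close> is the relation for
    \<open>x\<close> at \<open>b \<cdot> a\<close>.\<close>
  have act_K: "act a x \<in> K" if x: "x \<in> K" and a: "a \<in> A" for a x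
  proof -
    have "(\<Sum>(k, q)\<in>S. act b (act a x) (k, q) q) = (\<Sum>(k, q)\<in>S. act (b \<cdot> a) x (k, q) q)" if "b \<in> A" for b
      using that a by (intro sum.cong) (auto simp: act_mul)
    then show ?thesis using x by (auto simp: K_def act_def)
  qed
  have "supp x = {}" if "x \<in> K" for x
  proof (rule ccontr)
    assume "supp x \<noteq> {}"
    with that have "\<exists>x. x \<in> K \<and> supp x \<noteq> {}" by blast
    then obtain x where x: "x \<in> K" "supp x \<noteq> {}"
      and min: "\<And>y. y \<in> K \<Longrightarrow> supp y \<noteq> {} \<Longrightarrow> card (supp x) \<le> card (supp y)"
      using ex_has_least_nat[of "\<lambda>x. x \<in> K \<and> supp x \<noteq> {}" _ "\<lambda>x. card (supp x)"] by blast
    obtain k0 q0 where j0: "(k0, q0) \<in> supp x" using x(2) by auto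
    then have j0S: "(k0, q0) \<in> S" "k0 < L" "q0 < n k0" and x0: "x (k0, q0) \<noteq> 0"
      by (auto simp: supp_def S_def)
    define x0 where "x0 = x (k0, q0)"
    have x0v: "x0 \<in> vecs (n k0)" "x0 \<noteq> 0" using x(1) j0S(1) x0 by (auto simp: K_def x0_def)
    have xv: "x (l, p) \<in> vecs (n l)" if "(l, p) \<in> S" for l p using x(1) that by (auto simp: K_def)
    \<comment> \<open>If \<open>a\<close> kills the chosen entry, \<open>act a x\<close> is a
      relation of smaller support, hence zero by minimality.\<close>
    have kill: "act a x j = 0" if a: "a \<in> A" "mv (n k0) (\<rho> k0) a x0 = 0" and j: "j \<in> S" for a j
    proof -
      have sub: "supp (act a x) \<subseteq> supp x" by (auto simp: supp_def act_def)
      moreover have "(k0, q0) \<notin> supp (act a x)" using a(2) by (simp add: supp_def act_def x0_def)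
      ultimately have "supp (act a x) \<subset> supp x" using j0 by blast
      then have "card (supp (act a x)) < card (supp x)"
        using fin by (intro psubset_card_mono) (auto simp: supp_def)
      then have "supp (act a x) = {}" using min[OF act_K[OF x(1) a(1)]] by force
      then show ?thesis using j by (cases j) (auto simp: supp_def)
    qed
    have "\<exists>a\<in>A. mv (n k0) (\<rho> k0) a x0 = y" if "y \<in> vecs (n k0)" for y
      using simple[OF j0S(2)] x0v that by (auto simp: simple_def)
    then obtain \<alpha> where \<alpha>: "\<And>y. y \<in> vecs (n k0) \<Longrightarrow> \<alpha> y \<in> A \<and> mv (n k0) (\<rho> k0) (\<alpha> y) x0 = y"
      by metis
    \<comment> \<open>This is the map sending a x0 to a x(l, p). By \<open>kill\<close> it depends
      only on the vector a x0 and not on the element chosen by \<open>\<alpha>\<close>.\<close>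
    define F where "F l p y = mv (n l) (\<rho> l) (\<alpha> y) (x (l, p))" for l p y
    have F_eq: "F l p (mv (n k0) (\<rho> k0) a x0) = mv (n l) (\<rho> l) a (x (l, p))"
      if a: "a \<in> A" and lp: "(l, p) \<in> S" for a l p
    proof -
      let ?b = "\<alpha> (mv (n k0) (\<rho> k0) a x0)"
      have b: "?b \<in> A" using \<alpha> by simp
      have "act (?b - a) x (l, p) = 0"
        using \<alpha>[of "mv (n k0) (\<rho> k0) a x0"] a lp
        by (intro kill) (auto simp: vecs_diff mv_diff_left[OF rp[OF j0S(2)]])
      then show ?thesis using lp a b by (auto simp: act_def F_def S_def mv_diff_left[OF rp])
    qed
    have hom: "hom (n k0) (\<rho> k0) (n l) (\<rho> l) (F l p)" if lp: "(l, p) \<in> S" for l p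
    proof -
      have l: "l < L" using lp by (simp add: S_def)
      note r0 = rp[OF j0S(2)] and rl = rp[OF l]
      have "F l p (y + z) = F l p y + F l p z" if "y \<in> vecs (n k0)" "z \<in> vecs (n k0)" for y z
        using F_eq[OF _ lp, of "\<alpha> y + \<alpha> z"] \<alpha>[OF that(1)] \<alpha>[OF that(2)]
        by (simp add: vecs_add mv_add_left[OF r0] mv_add_left[OF rl]) (simp add: F_def)
      moreover have "F l p (fscale s y) = fscale s (F l p y)" if "y \<in> vecs (n k0)" for s y
        using F_eq[OF _ lp, of "fscale s (\<alpha> y)"] \<alpha>[OF that]
        by (simp add: vecs_scale mv_scale_left[OF r0] mv_scale_left[OF rl]) (simp add: F_def)
      moreover have "F l p (mv (n k0) (\<rho> k0) a y) = mv (n l) (\<rho> l) a (F l p y)"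
        if "a \<in> A" "y \<in> vecs (n k0)" for a y
        using F_eq[OF _ lp, of "a \<cdot> \<alpha> y"] \<alpha>[OF that(2)] that(1)
        by (simp add: mv_mul[OF r0] mv_mul[OF rl]) (simp add: F_def)
      ultimately show ?thesis by (simp add: hom_def) (simp add: F_def)
    qed
    have Fx0: "F l p x0 = x (l, p)" if lp: "(l, p) \<in> S" for l p
      using F_eq[OF unit_elt lp] x0v xv[OF lp] lp j0S(2) by (simp add: mv_unit[OF rp] S_def)
    have zero: "x (l, p) = 0" if lp: "(l, p) \<in> S" "l \<noteq> k0" for l p
    proof -
      have "\<not> similar (n k0) (\<rho> k0) (n l) (\<rho> l)" using lp j0S(2) by (intro nonsim) (auto simp: S_def)
      then show ?thesis using hom[OF lp(1)] Fx0[OF lp(1)] x0v(1)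
        unfolding similar_def by metis
    qed
    have "\<exists>s. x (k0, p) = fscale s x0" if "p < n k0" for p
    proof -
      have p: "(k0, p) \<in> S" using j0S(2) that by (simp add: S_def)
      obtain t where "\<And>y. y \<in> vecs (n k0) \<Longrightarrow> F k0 p y = fscale t y"
        by (rule schur_scalar[OF k simple[OF j0S(2)] hom[OF p]]) blast
      then show ?thesis using Fx0[OF p] x0v(1) by metis
    qed
    then obtain s where s: "\<And>p. p < n k0 \<Longrightarrow> x (k0, p) = fscale (s p) x0" by metis
    have s0: "s q0 = 1"
    proof -
      have "fscale (s q0) x0 = fscale 1 x0" using s[OF j0S(3)] by (simp add: x0_def)
      then show ?thesis using x0v(2) fun_vs.scale_right_imp_eq by blast
    qed
    have u: "unit_fun q0 \<in> vecs (n k0)" using j0S(3) by (rule vecs_unit_fun)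
    \<comment> \<open>All entries of \<open>x\<close> are now multiples of \<open>x0\<close>.
      Evaluating the relation at an element that carries \<open>x0\<close> to the unit vector
      \<open>q0\<close> leaves the single term \<open>s q0 = 1\<close>.\<close>
    let ?a = "\<alpha> (unit_fun q0)"
    have "0 = (\<Sum>(l, p)\<in>S. act ?a x (l, p) p)" using x(1) \<alpha>[OF u] by (simp add: K_def)
    also have "\<dots> = (\<Sum>l<L. \<Sum>p<n l. act ?a x (l, p) p)" by (simp add: S_def sum.Sigma)
    also have "\<dots> = (\<Sum>l<L. if l = k0 then \<Sum>p<n k0. act ?a x (k0, p) p else 0)"
      by (intro sum.cong refl) (auto simp: act_def zero S_def intro!: sum.neutral)
    also have "\<dots> = (\<Sum>p<n k0. act ?a x (k0, p) p)" using j0S(2) by simp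
    also have "\<dots> = (\<Sum>p<n k0. s p * unit_fun q0 p)"
      using \<alpha>[OF u] by (intro sum.cong refl) (simp add: act_def s mv_scale_right)
    also have "\<dots> = s q0"
      using j0S(3) by (simp add: unit_fun_def if_distrib[of "\<lambda>t. _ * t"] cong: if_cong)
    finally show False using s0 by simp
  qed
  moreover have "(\<lambda>(k, q). g k q) \<in> K"
  proof -
    have "(\<Sum>(k, q)\<in>S. act a (\<lambda>(k, q). g k q) (k, q) q) = 0" if "a \<in> A" for a
    proof -
      have "(\<Sum>(k, q)\<in>S. act a (\<lambda>(k, q). g k q) (k, q) q) = (\<Sum>k<L. \<Sum>q<n k. mv (n k) (\<rho> k) a (g k q) q)"
        by (simp add: S_def act_def sum.Sigma)
      then show ?thesis using rel[OF that] by simp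
    qed
    then show ?thesis using g by (auto simp: K_def S_def)
  qed
  ultimately have "supp (\<lambda>(k, q). g k q) = {}" by blast
  then show ?thesis using kq by (auto simp: supp_def S_def)
qed

text \<open>Take a minimal right submodule W with basis \<open>b\<close>. Right multiplication,
  written in rows, gives matrices with \<open>\<rho> (a \<cdot> b)\<close> = \<open>\<rho> a\<close>
  times \<open>\<rho> b\<close>, so acting on columns they form the left module dual to W, and this
  is simple because W is. The action is a parameter, as the lemma is applied both to A itself and to
  Hom_A(V, A).\<close>

lemma simple_right_submodule:
  fixes act :: "('i \<Rightarrow> 'k) \<Rightarrow> (nat \<Rightarrow> 'k) \<Rightarrow> ('i \<Rightarrow> 'k)"
  assumes S: "finite S" and supp: "\<And>h i. h \<in> W0 \<Longrightarrow> i \<notin> S \<Longrightarrow> h i = 0"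
    and sub0: "fun_vs.subspace W0" and nz0: "h0 \<in> W0" "h0 \<noteq> 0"
    and closed: "\<And>h a. h \<in> W0 \<Longrightarrow> a \<in> A \<Longrightarrow> act h a \<in> W0"
    and add_left: "\<And>h h' a. h \<in> W0 \<Longrightarrow> h' \<in> W0 \<Longrightarrow> a \<in> A \<Longrightarrow> act (h + h') a = act h a + act h' a"
    and scale_left: "\<And>s h a. h \<in> W0 \<Longrightarrow> a \<in> A \<Longrightarrow> act (fscale s h) a = fscale s (act h a)"
    and add_right: "\<And>h a b. h \<in> W0 \<Longrightarrow> a \<in> A \<Longrightarrow> b \<in> A \<Longrightarrow> act h (a + b) = act h a + act h b"
    and scale_right: "\<And>s h a. h \<in> W0 \<Longrightarrow> a \<in> A \<Longrightarrow> act h (fscale s a) = fscale s (act h a)"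
    and act_mul: "\<And>h a b. h \<in> W0 \<Longrightarrow> a \<in> A \<Longrightarrow> b \<in> A \<Longrightarrow> act h (a \<cdot> b) = act (act h a) b"
    and act_unit: "\<And>h. h \<in> W0 \<Longrightarrow> act h unit_elt = h"
  obtains n \<rho> b where "simple n \<rho>" "\<And>r. r < n \<Longrightarrow> b r \<in> W0" "\<And>r. r < n \<Longrightarrow> b r \<noteq> 0"
    "\<And>a r. a \<in> A \<Longrightarrow> r < n \<Longrightarrow> act (b r) a = (\<Sum>q<n. fscale (\<rho> a r q) (b q))"
proof -
  define P where "P W \<longleftrightarrow> fun_vs.subspace W \<and> W \<subseteq> W0 \<and> (\<exists>h\<in>W. h \<noteq> 0) \<and> (\<forall>h\<in>W. \<forall>a\<in>A. act h a \<in> W)" for W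
  have "P W0" using sub0 nz0 closed by (auto simp: P_def)
  then obtain W where W: "P W" and min: "\<And>W'. P W' \<Longrightarrow> fun_vs.dim W \<le> fun_vs.dim W'"
    using ex_has_least_nat[of P W0 fun_vs.dim] by blast
  have WW0: "h \<in> W0" if "h \<in> W" for h using W that by (auto simp: P_def)
  have subW: "fun_vs.subspace W" using W by (simp add: P_def)
  have closedW: "act h a \<in> W" if "h \<in> W" "a \<in> A" for h a using W that by (simp add: P_def)
  \<comment> \<open>Least dimension implies minimality for inclusion: a basis of \<open>W'\<close>
    extended to one of \<open>W\<close> cannot grow.\<close>
  have minimal: "W \<subseteq> W'" if W': "P W'" "W' \<subseteq> W" for W'
  proof -
    obtain B where B: "B \<subseteq> W'" "fun_vs.independent B" "W' \<subseteq> fun_vs.span B" "card B = fun_vs.dim W'"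
      using fun_vs.basis_exists .
    obtain C where C: "B \<subseteq> C" "C \<subseteq> W" "fun_vs.independent C" "W \<subseteq> fun_vs.span C"
      using fun_vs.maximal_independent_subset_extend[of B W] B W'(2) by blast
    have "finite C" by (rule independent_supported(1)[OF S C(3)]) (use C(2) WW0 supp in blast)
    moreover have "card C \<le> card B"
      using min[OF W'(1)] B(4) fun_vs.basis_card_eq_dim[OF C(2,4,3)] by simp
    ultimately have "B = C" using C(1) by (intro card_seteq) auto
    moreover have "fun_vs.span B \<subseteq> W'" using W'(1) B(1) by (intro fun_vs.span_minimal) (auto simp: P_def)
    ultimately show ?thesis using C(4) by blast
  qed
  obtain B where B: "B \<subseteq> W" "fun_vs.independent B" "W \<subseteq> fun_vs.span B"
    using fun_vs.basis_exists .
  have finB: "finite B" by (rule independent_supported(1)[OF S B(2)]) (use B(1) WW0 supp in blast)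
  define n where "n = card B"
  obtain b where b: "bij_betw b {..<n} B"
    using ex_bij_betw_nat_finite[OF finB] by (auto simp: n_def lessThan_atLeast0)
  have bW: "b r \<in> W" if "r < n" for r using b B(1) that by (auto simp: bij_betw_def)
  define co where "co v q = fun_vs.representation B v (b q)" for v q
  have co_expand: "(\<Sum>q<n. fscale (co v q) (b q)) = v" if "v \<in> W" for v
  proof -
    have "(\<Sum>q<n. fscale (co v q) (b q)) = (\<Sum>x\<in>B. fscale (fun_vs.representation B v x) x)"
      unfolding co_def by (rule sum.reindex_bij_betw[OF b])
    also have "\<dots> = v" using fun_vs.sum_representation_eq[OF B(2) _ finB] B(3) that by blast
    finally show ?thesis .
  qed
  have co_scale: "co (fscale s v) q = s * co v q" if "v \<in> W" for s v q
    using fun_vs.representation_scale[OF B(2)] B(3) that by (auto simp: co_def)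
  have co_add: "co (u + v) q = co u q + co v q" if "u \<in> W" "v \<in> W" for u v q
    using fun_vs.representation_add[OF B(2) subsetD[OF B(3) that(2)] subsetD[OF B(3) that(1)]]
    by (simp add: co_def)
  have co_sum: "co (\<Sum>i\<in>T. f i) q = (\<Sum>i\<in>T. co (f i) q)" if "\<And>i. i \<in> T \<Longrightarrow> f i \<in> W" for f :: "nat \<Rightarrow> _" and T q
  proof -
    have "f i \<in> fun_vs.span B" if "i \<in> T" for i using B(3) \<open>\<And>i. i \<in> T \<Longrightarrow> f i \<in> W\<close> that by blast
    then show ?thesis using fun_vs.representation_sum[OF B(2), of T f] by (simp add: co_def)
  qed
  have co_basis: "co (b r) q = (if q = r then 1 else 0)" if "r < n" "q < n" for r q
  proof -
    have "b r \<in> B" "b q = b r \<longleftrightarrow> q = r" using b that by (auto simp: bij_betw_def inj_on_def)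
    then show ?thesis using fun_vs.representation_basis[OF B(2)] by (simp add: co_def)
  qed
  have act_sum: "act (\<Sum>i\<in>T. f i) a = (\<Sum>i\<in>T. act (f i) a)"
    if "finite T" "a \<in> A" "\<And>i. i \<in> T \<Longrightarrow> f i \<in> W0" for f :: "nat \<Rightarrow> _" and T a
    using that(1,3)
  proof (induction T)
    case empty
    have "act (fscale 0 h0) a = fscale 0 (act h0 a)" by (rule scale_left[OF nz0(1) that(2)])
    then have "act 0 a = 0" by simp
    then show ?case by (simp only: sum.empty)
  next
    case (insert x T)
    have "act (\<Sum>i\<in>insert x T. f i) a = act (f x + (\<Sum>i\<in>T. f i)) a"
      by (simp only: sum.insert[OF insert.hyps])
    also have "\<dots> = act (f x) a + act (\<Sum>i\<in>T. f i) a"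
      using insert.prems by (intro add_left that(2) fun_vs.subspace_sum[OF sub0]) auto
    also have "act (\<Sum>i\<in>T. f i) a = (\<Sum>i\<in>T. act (f i) a)"
      using insert.prems by (intro insert.IH) simp
    also have "act (f x) a + \<dots> = (\<Sum>i\<in>insert x T. act (f i) a)"
      by (simp only: sum.insert[OF insert.hyps])
    finally show ?case .
  qed
  define \<rho> where "\<rho> a r q = co (act (b r) a) q" for a r q
  have act_b: "act (b r) a = (\<Sum>q<n. fscale (\<rho> a r q) (b q))" if "a \<in> A" "r < n" for a r
    unfolding \<rho>_def by (rule co_expand[symmetric]) (rule closedW[OF bW[OF that(2)] that(1)])
  have act_comb: "act (\<Sum>r<n. fscale (t r) (b r)) a = (\<Sum>r<n. fscale (t r) (act (b r) a))"
    and co_act_comb: "co (act (\<Sum>r<n. fscale (t r) (b r)) a) q = (\<Sum>r<n. t r * \<rho> a r q)"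
    if a: "a \<in> A" for a t q
  proof -
    have "act (\<Sum>r<n. fscale (t r) (b r)) a = (\<Sum>r<n. act (fscale (t r) (b r)) a)"
      by (rule act_sum[OF _ a]) (use bW WW0 fun_vs.subspace_scale[OF sub0] in auto)
    also have "\<dots> = (\<Sum>r<n. fscale (t r) (act (b r) a))"
      by (intro sum.cong refl scale_left a) (use bW WW0 in auto)
    finally show e: "act (\<Sum>r<n. fscale (t r) (b r)) a = (\<Sum>r<n. fscale (t r) (act (b r) a))" .
    have "co (\<Sum>r<n. fscale (t r) (act (b r) a)) q = (\<Sum>r<n. co (fscale (t r) (act (b r) a)) q)"
      by (rule co_sum) (use bW closedW a fun_vs.subspace_scale[OF subW] in auto)
    then show "co (act (\<Sum>r<n. fscale (t r) (b r)) a) q = (\<Sum>r<n. t r * \<rho> a r q)"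
      unfolding e by (simp add: \<rho>_def co_scale bW closedW a)
  qed
  have rep: "rep n \<rho>"
    unfolding rep_def
  proof (intro allI impI conjI ballI)
    fix r q assume r: "r < n" and q: "q < n"
    fix a assume a: "a \<in> A"
    show "\<rho> (fscale s a) r q = s * \<rho> a r q" for s
      using bW[OF r] a by (simp add: \<rho>_def scale_right WW0 co_scale closedW)
    fix a' assume a': "a' \<in> A"
    show "\<rho> (a + a') r q = \<rho> a r q + \<rho> a' r q"
      using bW[OF r] a a' by (simp add: \<rho>_def add_right WW0 co_add closedW)
    have "\<rho> (a \<cdot> a') r q = co (act (act (b r) a) a') q"
      using bW[OF r] a a' by (simp add: \<rho>_def act_mul WW0)
    then show "\<rho> (a \<cdot> a') r q = (\<Sum>p<n. \<rho> a r p * \<rho> a' p q)"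
      unfolding act_b[OF a r] co_act_comb[OF a'] .
  next
    fix r q assume "r < n" "q < n"
    then show "\<rho> unit_elt r q = (if r = q then 1 else 0)"
      using bW by (auto simp: \<rho>_def act_unit WW0 co_basis)
  qed
  have "n > 0"
  proof (rule ccontr)
    assume "\<not> n > 0"
    then have "W \<subseteq> {0}" using co_expand by fastforce
    then show False using W by (auto simp: P_def)
  qed
  moreover have "\<exists>a\<in>A. mv n \<rho> a x = y" if x: "x \<in> vecs n" "x \<noteq> 0" and y: "y \<in> vecs n" for x y
  proof (rule ccontr)
    assume no: "\<not> ?thesis"
    \<comment> \<open>\<open>U\<close> is the submodule generated by \<open>x\<close>. If it misses
      \<open>y\<close>, some nonzero row \<open>\<eta>\<close> annihilates it and defines a nonzero
      \<open>w\<close> in \<open>W\<close>. By minimality \<open>w\<close> generates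
      \<open>W\<close>, so some \<open>act w a\<close> equals \<open>b p\<close> with
      \<open>x p\<close> nonzero; pairing with \<open>x\<close> then yields both \<open>x p\<close>
      and 0.\<close>
    define U where "U = (\<lambda>a. mv n \<rho> a x) ` A"
    have subU: "fun_vs.subspace U"
    proof (rule fun_vs.subspaceI)
      show "0 \<in> U" unfolding U_def by (rule image_eqI[of _ _ 0]) (simp_all add: mv_zero_left[OF rep])
    next
      fix u v assume "u \<in> U" "v \<in> U"
      then obtain a a' where "a \<in> A" "a' \<in> A" "u = mv n \<rho> a x" "v = mv n \<rho> a' x" by (auto simp: U_def)
      then show "u + v \<in> U"
        unfolding U_def by (intro image_eqI[of _ _ "a + a'"]) (auto simp: mv_add_left[OF rep] vecs_add)
    next
      fix s u assume "u \<in> U"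
      then obtain a where "a \<in> A" "u = mv n \<rho> a x" by (auto simp: U_def)
      then show "fscale s u \<in> U"
        unfolding U_def by (intro image_eqI[of _ _ "fscale s a"]) (auto simp: mv_scale_left[OF rep] vecs_scale)
    qed
    have yU: "y \<notin> U" using no by (auto simp: U_def)
    have suppU: "f i = 0" if "f \<in> U" "i \<notin> {..<n}" for f i using that by (auto simp: U_def mv_def)
    have suppy: "y i = 0" if "i \<notin> {..<n}" for i using that y by (simp add: vecs_def)
    obtain \<eta> where \<eta>: "\<And>u. u \<in> U \<Longrightarrow> (\<Sum>i<n. \<eta> i * u i) = 0" "(\<Sum>i<n. \<eta> i * y i) = 1"
    proof (rule separating_functional[of "{..<n}" U y])
      show "f i = 0" if "f \<in> U" "i \<notin> {..<n}" for f i using that by (rule suppU)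
      show "y i = 0" if "i \<notin> {..<n}" for i using that by (rule suppy)
    qed (use subU yU in auto)
    define w where "w = (\<Sum>r<n. fscale (\<eta> r) (b r))"
    have wW: "w \<in> W" unfolding w_def
      by (intro fun_vs.subspace_sum[OF subW] fun_vs.subspace_scale[OF subW] bW) simp
    have "w \<noteq> 0"
    proof
      assume w0: "w = 0"
      have "\<eta> r = 0" if "r < n" for r
      proof -
        have "co w r = (\<Sum>p<n. co (fscale (\<eta> p) (b p)) r)"
          unfolding w_def by (rule co_sum) (use bW fun_vs.subspace_scale[OF subW] in auto)
        also have "\<dots> = (\<Sum>p<n. if p = r then \<eta> p else 0)"
          by (intro sum.cong refl) (use that in \<open>auto simp: co_scale bW co_basis\<close>)
        also have "\<dots> = \<eta> r" using that by simp
        finally show ?thesis using co_scale[OF wW, of 0 r] w0 by simp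
      qed
      then show False using \<eta>(2) by simp
    qed
    define W' where "W' = act w ` A"
    have "P W'" unfolding P_def
    proof (intro conjI ballI)
      show "fun_vs.subspace W'"
      proof (rule fun_vs.subspaceI)
        show "0 \<in> W'" unfolding W'_def
          using scale_right[OF WW0[OF wW], of 0 0] by (intro image_eqI[of _ _ 0]) simp_all
      next
        fix u v assume "u \<in> W'" "v \<in> W'"
        then obtain a a' where "a \<in> A" "a' \<in> A" "u = act w a" "v = act w a'" by (auto simp: W'_def)
        then show "u + v \<in> W'" unfolding W'_def
          by (intro image_eqI[of _ _ "a + a'"]) (auto simp: add_right WW0 wW vecs_add)
      next
        fix s u assume "u \<in> W'"
        then obtain a where "a \<in> A" "u = act w a" by (auto simp: W'_def)
        then show "fscale s u \<in> W'" unfolding W'_def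
          by (intro image_eqI[of _ _ "fscale s a"]) (auto simp: scale_right WW0 wW vecs_scale)
      qed
      show "W' \<subseteq> W0" using closed[OF WW0[OF wW]] by (auto simp: W'_def)
      show "\<exists>h\<in>W'. h \<noteq> 0"
        using \<open>w \<noteq> 0\<close> act_unit[OF WW0[OF wW]] unit_elt unfolding W'_def by (metis image_eqI)
      fix h a assume "h \<in> W'" "a \<in> A"
      then obtain a' where "a' \<in> A" "h = act w a'" by (auto simp: W'_def)
      then show "act h a \<in> W'" unfolding W'_def using \<open>a \<in> A\<close>
        by (intro image_eqI[of _ _ "a' \<cdot> a"]) (auto simp: act_mul WW0 wW)
    qed
    moreover have "W' \<subseteq> W" using closedW[OF wW] by (auto simp: W'_def)
    ultimately have WW': "W \<subseteq> W'" by (rule minimal)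
    obtain p where p: "p < n" "x p \<noteq> 0"
    proof -
      have "\<exists>p. x p \<noteq> 0" using x(2) by (auto simp: fun_eq_iff)
      then show ?thesis using x(1) that by (auto simp: vecs_def) (meson not_le)
    qed
    obtain a where a: "a \<in> A" "b p = act w a" using WW' bW[OF p(1)] by (auto simp: W'_def)
    have row: "(\<Sum>r<n. \<eta> r * \<rho> a r q) = (if q = p then 1 else 0)" if "q < n" for q
      using co_act_comb[OF a(1), of \<eta> q] co_basis[OF p(1) that] a(2) by (simp add: w_def)
    have "0 = (\<Sum>r<n. \<eta> r * mv n \<rho> a x r)" using \<eta>(1)[of "mv n \<rho> a x"] a(1) by (simp add: U_def)
    also have "\<dots> = (\<Sum>r<n. \<Sum>q<n. \<eta> r * \<rho> a r q * x q)"
      by (simp add: mv_def sum_distrib_left mult.assoc)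
    also have "\<dots> = (\<Sum>q<n. (\<Sum>r<n. \<eta> r * \<rho> a r q) * x q)"
      by (subst sum.swap) (simp add: sum_distrib_right)
    also have "\<dots> = x p" using p(1) by (simp add: row if_distrib[of "\<lambda>t. t * _"] cong: if_cong)
    finally show False using p(2) by simp
  qed
  ultimately have "simple n \<rho>" using rep by (simp add: simple_def)
  moreover have "b r \<noteq> 0" if "r < n" for r
    using co_basis[OF that that] co_scale[OF bW[OF that], of 0 r] by auto
  ultimately show thesis using that[of n \<rho> b] bW WW0 act_b by blast
qed

section \<open>Selfinjectivity\<close>

text \<open>In a right selfinjective ring, a finitely generated left ideal is the left annihilator of its
  right annihilator (Ikeda and Nakayama). With \<open>K\<close> the right annihilator of the remaining generators,
  \<open>g y \<mapsto> b y\<close> is a well defined map \<open>g K \<rightarrow> A\<close>, hence left multiplication by some \<open>a\<close>, and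
  \<open>b - a g\<close> kills \<open>K\<close>.\<close>

lemma double_annihilator:
  assumes inj: "selfinjective d c"
    and L: "0 \<in> L" "\<And>x y. x \<in> L \<Longrightarrow> y \<in> L \<Longrightarrow> x + y \<in> L" "\<And>a x. a \<in> A \<Longrightarrow> x \<in> L \<Longrightarrow> a \<cdot> x \<in> L"
  shows "set gs \<subseteq> A \<inter> L \<Longrightarrow> b \<in> A \<Longrightarrow> (\<And>y. y \<in> A \<Longrightarrow> \<forall>g\<in>set gs. g \<cdot> y = 0 \<Longrightarrow> b \<cdot> y = 0) \<Longrightarrow> b \<in> L"
proof (induction gs arbitrary: b)
  case Nil
  \<comment> \<open>Without generators every element satisfies the annihilation condition, in
    particular the unit.\<close>
  then have "b \<cdot> unit_elt = 0" by (auto intro: Nil.prems)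
  then have "b = 0" by (simp only: mul_unit_right[OF Nil.prems(2)])
  with L(1) show ?case by metis
next
  case (Cons g gs)
  have g: "g \<in> A" "g \<in> L" and gs: "set gs \<subseteq> A \<inter> L" using Cons.prems(1) by auto
  define K where "K = {y \<in> A. \<forall>h\<in>set gs. h \<cdot> y = 0}"
  have K_add: "y + z \<in> K" and K_diff: "y - z \<in> K" if "y \<in> K" "z \<in> K" for y z
    using that by (auto simp: K_def vecs_add vecs_diff mul_add_right mul_diff_right)
  have K_scale: "fscale s y \<in> K" if "y \<in> K" for s y
    using that by (auto simp: K_def vecs_scale mul_scale_right)
  have K_mul: "y \<cdot> a \<in> K" if "y \<in> K" "a \<in> A" for y a
  proof -
    have "h \<cdot> (y \<cdot> a) = 0" if "h \<in> set gs" for h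
    proof -
      have "h \<cdot> y \<cdot> a = h \<cdot> (y \<cdot> a)" using gs that \<open>y \<in> K\<close> \<open>a \<in> A\<close> by (intro mul_assoc) (auto simp: K_def)
      moreover have "h \<cdot> y = 0" using that \<open>y \<in> K\<close> by (simp add: K_def)
      ultimately show ?thesis by simp
    qed
    then show ?thesis by (simp add: K_def)
  qed
  have KA: "y \<in> A" if "y \<in> K" for y using that by (simp add: K_def)
  have K0: "0 \<in> K" by (simp add: K_def)
  define I where "I = (\<lambda>y. g \<cdot> y) ` K"
  define f where "f z = b \<cdot> (SOME y. y \<in> K \<and> g \<cdot> y = z)" for z
  have f: "f (g \<cdot> y) = b \<cdot> y" if y: "y \<in> K" for y
  proof -
    let ?y = "SOME y'. y' \<in> K \<and> g \<cdot> y' = g \<cdot> y"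
    have y': "?y \<in> K" "g \<cdot> ?y = g \<cdot> y" using someI[of "\<lambda>y'. y' \<in> K \<and> g \<cdot> y' = g \<cdot> y" y] y by auto
    have "?y - y \<in> K" using y'(1) y by (rule K_diff)
    then have "?y - y \<in> A" "\<forall>h\<in>set (g # gs). h \<cdot> (?y - y) = 0"
      using y'(2) by (simp_all add: K_def mul_diff_right)
    then have "b \<cdot> (?y - y) = 0" by (rule Cons.prems(3))
    then show ?thesis by (simp add: f_def mul_diff_right)
  qed
  have I_right: "right_ideal d c I"
    unfolding right_ideal_def
  proof (intro conjI ballI allI)
    show "I \<subseteq> vecs d" by (auto simp: I_def)
    have "g \<cdot> 0 \<in> I" using K0 by (simp only: I_def imageI)
    then show "(\<lambda>_. 0) \<in> I" by (simp add: zero_fun_def[symmetric])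
    fix x assume "x \<in> I"
    then obtain u where u: "u \<in> K" "x = g \<cdot> u" by (auto simp: I_def)
    show "amul c d x a \<in> I" if "a \<in> A" for a
      using u K_mul[OF u(1) that] that by (auto simp: I_def mul_assoc g KA)
    have "fscale s x \<in> I" for s
      unfolding I_def using u K_scale[OF u(1)] by (intro image_eqI[of _ _ "fscale s u"]) (auto simp: mul_scale_right)
    then show "(\<lambda>i. s * x i) \<in> I" for s by (simp add: fscale_def)
    fix y assume "y \<in> I"
    then obtain v where v: "v \<in> K" "y = g \<cdot> v" by (auto simp: I_def)
    have "x + y \<in> I"
      unfolding I_def using u v K_add by (intro image_eqI[of _ _ "u + v"]) (auto simp: mul_add_right)
    then show "(\<lambda>i. x i + y i) \<in> I" by (simp add: plus_fun_def)
  qed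
  have f_hom: "right_hom d c I f"
    unfolding right_hom_def
  proof (intro conjI ballI allI)
    fix x assume "x \<in> I"
    then obtain u where u: "u \<in> K" "x = g \<cdot> u" by (auto simp: I_def)
    show "f x \<in> vecs d" by (simp add: f_def)
    show "f (amul c d x a) = amul c d (f x) a" if "a \<in> A" for a
    proof -
      have "x \<cdot> a = g \<cdot> (u \<cdot> a)" unfolding u(2) by (rule mul_assoc[OF g(1) KA[OF u(1)] that])
      then have "f (x \<cdot> a) = b \<cdot> (u \<cdot> a)" using f[OF K_mul[OF u(1) that]] by simp
      also have "\<dots> = b \<cdot> u \<cdot> a" by (rule mul_assoc[OF Cons.prems(2) KA[OF u(1)] that, symmetric])
      finally show ?thesis unfolding u(2) f[OF u(1)] .
    qed
    have "f (fscale s x) = fscale s (f x)" for s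
      using f[OF K_scale[OF u(1), of s]] f[OF u(1)] by (simp only: u(2) mul_scale_right)
    then show "f (\<lambda>i. s * x i) = (\<lambda>i. s * f x i)" for s by (simp add: fscale_def)
    fix y assume "y \<in> I"
    then obtain v where v: "v \<in> K" "y = g \<cdot> v" by (auto simp: I_def)
    have "f (x + y) = f x + f y"
      using f[OF K_add[OF u(1) v(1)]] f[OF u(1)] f[OF v(1)] by (simp only: u(2) v(2) mul_add_right)
    then show "f (\<lambda>i. x i + y i) = (\<lambda>i. f x i + f y i)" by (simp add: plus_fun_def)
  qed
  obtain a where a: "a \<in> A" "\<And>x. x \<in> I \<Longrightarrow> f x = a \<cdot> x"
    using inj I_right f_hom unfolding selfinjective_def by blast
  have "b - a \<cdot> g \<in> L"
  proof (rule Cons.IH[OF gs])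
    show "b - a \<cdot> g \<in> A" using Cons.prems(2) by (simp add: vecs_diff)
    fix y assume y: "y \<in> A" "\<forall>h\<in>set gs. h \<cdot> y = 0"
    then have yK: "y \<in> K" by (simp add: K_def)
    have "b \<cdot> y = a \<cdot> (g \<cdot> y)" using a(2)[of "g \<cdot> y"] f[OF yK] yK by (simp add: I_def)
    then show "(b - a \<cdot> g) \<cdot> y = 0" by (simp add: mul_diff_left mul_assoc a(1) g(1) y(1))
  qed
  then have "(b - a \<cdot> g) + a \<cdot> g \<in> L" by (rule L(2)) (rule L(3)[OF a(1) g(2)])
  then show ?case by simp
qed

text \<open>A link is a nonzero bilinear map \<open>DA \<times> V \<rightarrow> V'\<close> induced by a homomorphism
  \<open>DA \<otimes>\<^sub>A V \<rightarrow> V'\<close>, written through the elements \<open>s r r'\<close> of \<open>A\<close> that represent its matrix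
  coefficients as functionals on \<open>DA\<close>.\<close>

definition link :: "nat \<Rightarrow> ((nat \<Rightarrow> 'k) \<Rightarrow> nat \<Rightarrow> nat \<Rightarrow> 'k) \<Rightarrow> nat \<Rightarrow> ((nat \<Rightarrow> 'k) \<Rightarrow> nat \<Rightarrow> nat \<Rightarrow> 'k)
    \<Rightarrow> (nat \<Rightarrow> nat \<Rightarrow> nat \<Rightarrow> 'k) \<Rightarrow> bool" where
  "link n \<rho> n' \<rho>' s \<longleftrightarrow> (\<forall>r r'. s r r' \<in> A) \<and>
    (\<forall>a\<in>A. \<forall>r<n. \<forall>r'<n'. a \<cdot> s r r' = (\<Sum>x<n. fscale (\<rho> a x r) (s x r'))) \<and>
    (\<forall>a\<in>A. \<forall>r<n. \<forall>r'<n'. s r r' \<cdot> a = (\<Sum>x<n'. fscale (\<rho>' a r' x) (s r x))) \<and>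
    (\<exists>r<n. \<exists>r'<n'. s r r' \<noteq> 0)"

text \<open>For f in DA let [f] send the basis vector e_r of V to the sum of the f(s r r') e_r'. As
  (f a)(x) = f(a x) and (a f)(x) = f(x a), the first identity says [f a] = [f] a, the balancedness
  over A, and the second says [a f] = a [f], the linearity.\<close>

lemma link_left: "link n \<rho> n' \<rho>' s \<Longrightarrow> a \<in> A \<Longrightarrow> r < n \<Longrightarrow> r' < n' \<Longrightarrow>
    a \<cdot> s r r' = (\<Sum>x<n. fscale (\<rho> a x r) (s x r'))"
  and link_right: "link n \<rho> n' \<rho>' s \<Longrightarrow> a \<in> A \<Longrightarrow> r < n \<Longrightarrow> r' < n' \<Longrightarrow>
    s r r' \<cdot> a = (\<Sum>x<n'. fscale (\<rho>' a r' x) (s r x))"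
  and link_closed: "link n \<rho> n' \<rho>' s \<Longrightarrow> s r r' \<in> A"
  by (simp_all add: link_def)

text \<open>The elements \<open>s r r'\<close> are the values at the basis of V of homomorphisms V
  -> A that form a basis of a simple right submodule of Hom_A(V, A).\<close>

lemma next_simple:
  assumes inj: "selfinjective d c" and V: "simple n \<rho>"
  obtains n' \<rho>' s where "simple n' \<rho>'" "link n \<rho> n' \<rho>' s"
proof -
  have n: "n > 0" and rep: "rep n \<rho>" using V by (auto simp: simple_def)
  define e where "e = (unit_fun 0 :: nat \<Rightarrow> 'k)"
  have e: "e \<in> vecs n" "e \<noteq> 0" using n by (simp_all add: e_def vecs_unit_fun unit_fun_nonzero)
  define I where "I = {a \<in> A. mv n \<rho> a e = 0}"
  have I_diff: "a - b \<in> I" if "a \<in> A" "b \<in> A" "mv n \<rho> a e = mv n \<rho> b e" for a b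
    using that by (simp add: I_def vecs_diff mv_diff_left[OF rep])
  obtain B where B: "B \<subseteq> I" "fun_vs.independent B" "I \<subseteq> fun_vs.span B"
    using fun_vs.basis_exists .
  have "finite B" by (rule independent_supported(1)[OF _ B(2), of "{..<d}"]) (use B(1) in \<open>auto simp: I_def vecs_def\<close>)
  then obtain gs where gs: "set gs = B" using finite_list by blast
  \<comment> \<open>If \<open>I\<close> had zero right annihilator, the double annihilator property
    would put the unit into \<open>I\<close>, although the unit fixes the nonzero vector
    \<open>e\<close>.\<close>
  have "\<exists>y\<in>A. y \<noteq> 0 \<and> (\<forall>a\<in>I. a \<cdot> y = 0)"
  proof (rule ccontr)
    assume no: "\<not> ?thesis"
    have "unit_elt \<in> I"
    proof (rule double_annihilator[OF inj, of I gs])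
      show "0 \<in> I" by (simp add: I_def mv_zero_left[OF rep])
      show "x + y \<in> I" if "x \<in> I" "y \<in> I" for x y
        using that by (simp add: I_def vecs_add mv_add_left[OF rep])
      show "a \<cdot> x \<in> I" if "a \<in> A" "x \<in> I" for a x
        using that by (simp add: I_def mv_mul[OF rep])
      show "set gs \<subseteq> A \<inter> I" using gs B(1) by (auto simp: I_def)
      fix y assume y: "y \<in> A" "\<forall>g\<in>set gs. g \<cdot> y = 0"
      have "fun_vs.subspace {a. a \<cdot> y = 0}"
        by (rule fun_vs.subspaceI) (auto simp: mul_add_left mul_scale_left)
      then have "fun_vs.span B \<subseteq> {a. a \<cdot> y = 0}" using y gs by (intro fun_vs.span_minimal) auto
      then have "\<forall>a\<in>I. a \<cdot> y = 0" using B(3) by blast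
      then have "y = 0" using no y(1) by blast
      then show "unit_elt \<cdot> y = 0" by simp
    qed simp
    then show False using e by (simp add: I_def mv_unit[OF rep])
  qed
  then obtain y where y: "y \<in> A" "y \<noteq> 0" "\<And>a. a \<in> I \<Longrightarrow> a \<cdot> y = 0" by blast
  have "\<exists>a\<in>A. mv n \<rho> a e = unit_fun r" if "r < n" for r
    using V e vecs_unit_fun[OF that] unfolding simple_def by blast
  then obtain \<alpha> where \<alpha>: "\<And>r. r < n \<Longrightarrow> \<alpha> r \<in> A \<and> mv n \<rho> (\<alpha> r) e = unit_fun r" by metis
  define row where "row h r = (\<lambda>j. h (r, j))" for h :: "nat \<times> nat \<Rightarrow> 'k" and r
  have row_add: "row (h + h') r = row h r + row h' r"
    and row_scale: "row (fscale s h) r = fscale s (row h r)" for h h' s r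
    by (auto simp: row_def fun_eq_iff)
  have row_zero: "row 0 r = 0" for r by (auto simp: row_def fun_eq_iff)
  have row_sum: "row (\<Sum>i\<in>T. f i) r = (\<Sum>i\<in>T. row (f i) r)" for f :: "nat \<Rightarrow> _" and T r
    using sum_comp_morphism[of "\<lambda>h. row h r" f T] by (simp add: row_zero row_add o_def)
  \<comment> \<open>\<open>H\<close> is Hom_A(V, A): \<open>row h r\<close> is the image of the
    basis vector r. The entries outside the index range are fixed to be zero, which gives a finite
    support.\<close>
  define H where "H = {h. (\<forall>r j. r \<ge> n \<or> j \<ge> d \<longrightarrow> h (r, j) = 0) \<and>
      (\<forall>a\<in>A. \<forall>r<n. a \<cdot> row h r = (\<Sum>x<n. fscale (\<rho> a x r) (row h x)))}"
  define act where "act h a = (\<lambda>(r, j). (row h r \<cdot> a) j)" for h and a :: "nat \<Rightarrow> 'k"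
  have row_act: "row (act h a) r = row h r \<cdot> a" for h a r
    by (simp add: row_def act_def)
  have row_eqI: "h = h'" if "\<And>r. row h r = row h' r" for h h'
  proof (rule ext, clarify)
    fix r j
    show "h (r, j) = h' (r, j)" using fun_cong[OF that[of r], of j] by (simp add: row_def)
  qed
  have rowA: "row h r \<in> A" if "h \<in> H" for h r
    using that by (auto simp: H_def row_def vecs_def)
  have row_hom: "a \<cdot> row h r = (\<Sum>x<n. fscale (\<rho> a x r) (row h x))" if "h \<in> H" "a \<in> A" "r < n" for h a r
    using that by (simp add: H_def)
  have HI: "h \<in> H" if "\<And>r j. r \<ge> n \<or> j \<ge> d \<Longrightarrow> h (r, j) = 0"
    "\<And>a r. a \<in> A \<Longrightarrow> r < n \<Longrightarrow> a \<cdot> row h r = (\<Sum>x<n. fscale (\<rho> a x r) (row h x))" for h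
    using that by (simp add: H_def)
  have H0: "h (r, j) = 0" if "h \<in> H" "r \<ge> n \<or> j \<ge> d" for h r j
    using that by (auto simp: H_def)
  have subH: "fun_vs.subspace H"
  proof (rule fun_vs.subspaceI)
    show "0 \<in> H" by (rule HI) (simp_all add: row_zero)
    show "h + h' \<in> H" if "h \<in> H" "h' \<in> H" for h h'
      using that by (intro HI) (auto simp: H0 row_add mul_add_right row_hom fun_vs.scale_right_distrib sum.distrib)
    show "fscale s h \<in> H" if "h \<in> H" for s h
      using that by (intro HI)
        (auto simp: H0 row_scale mul_scale_right row_hom fun_vs.scale_sum_right mult.commute)
  qed
  have act_H: "act h a \<in> H" if h: "h \<in> H" and a: "a \<in> A" for h a
  proof (rule HI)
    show "act h a (r, j) = 0" if "r \<ge> n \<or> j \<ge> d" for r j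
    proof (cases "j \<ge> d")
      case True
      then show ?thesis using mul_closed[of "row h r" a] by (simp add: act_def vecs_def)
    next
      case False
      then have "row h r = 0" using that h H0 by (auto simp: row_def fun_eq_iff)
      then show ?thesis by (simp add: act_def)
    qed
    fix b r assume b: "b \<in> A" "r < n"
    have "b \<cdot> (row h r \<cdot> a) = b \<cdot> row h r \<cdot> a" by (rule mul_assoc[OF b(1) rowA[OF h] a, symmetric])
    then show "b \<cdot> row (act h a) r = (\<Sum>x<n. fscale (\<rho> b x r) (row (act h a) x))"
      by (simp add: row_act row_hom[OF h b] mul_sum_left mul_scale_left)
  qed
  \<comment> \<open>This is the homomorphism a e |-> a y on the basis vectors, as
    \<open>\<alpha> r\<close> carries \<open>e\<close> to the basis vector r.\<close>
  define h0 where "h0 = (\<lambda>(r, j). if r < n then (\<alpha> r \<cdot> y) j else 0)"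
  have row_h0: "row h0 r = \<alpha> r \<cdot> y" if "r < n" for r using that by (simp add: row_def h0_def)
  have h0: "h0 \<in> H"
  proof (rule HI)
    show "h0 (r, j) = 0" if "r \<ge> n \<or> j \<ge> d" for r j
      using that mul_closed[of "\<alpha> r" y] by (auto simp: h0_def vecs_def)
    fix a r assume a: "a \<in> A" and r: "r < n"
    let ?b = "\<Sum>x<n. fscale (\<rho> a x r) (\<alpha> x)"
    have "mv n \<rho> (a \<cdot> \<alpha> r) e = mv n \<rho> a (unit_fun r)" using \<alpha>[OF r] a by (simp add: mv_mul[OF rep])
    also have "\<dots> = (\<Sum>x<n. fscale (mv n \<rho> a (unit_fun r) x) (unit_fun x))" by (rule vecs_expand) simp
    also have "\<dots> = (\<Sum>x<n. mv n \<rho> (fscale (\<rho> a x r) (\<alpha> x)) e)"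
      using \<alpha> r by (intro sum.cong refl) (simp add: mv_unit_fun mv_scale_left[OF rep])
    also have "\<dots> = mv n \<rho> ?b e" using \<alpha> by (intro mv_sum_left[OF rep, symmetric]) (simp add: vecs_scale)
    finally have "a \<cdot> \<alpha> r - ?b \<in> I" using \<alpha> by (intro I_diff vecs_sum vecs_scale mul_closed) auto
    then have "(a \<cdot> \<alpha> r - ?b) \<cdot> y = 0" by (rule y(3))
    then have "a \<cdot> \<alpha> r \<cdot> y = ?b \<cdot> y" by (simp add: mul_diff_left)
    moreover have "a \<cdot> \<alpha> r \<cdot> y = a \<cdot> (\<alpha> r \<cdot> y)" using a \<alpha>[OF r] y(1) by (intro mul_assoc) auto
    ultimately show "a \<cdot> row h0 r = (\<Sum>x<n. fscale (\<rho> a x r) (row h0 x))"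
      using r by (simp add: row_h0 mul_sum_left mul_scale_left)
  qed
  have "h0 \<noteq> 0"
  proof
    assume "h0 = 0"
    have "unit_elt - \<alpha> 0 \<in> I" using \<alpha>[OF n] e(1) by (intro I_diff) (auto simp: mv_unit[OF rep] e_def[symmetric])
    then have "(unit_elt - \<alpha> 0) \<cdot> y = 0" by (rule y(3))
    then have "y = \<alpha> 0 \<cdot> y" by (simp add: mul_diff_left mul_unit_left y(1))
    then show False using row_h0[OF n] row_zero[of 0] \<open>h0 = 0\<close> y(2) by simp
  qed
  obtain n' \<rho>' b where simple': "simple n' \<rho>'" and b: "\<And>r. r < n' \<Longrightarrow> b r \<in> H" "\<And>r. r < n' \<Longrightarrow> b r \<noteq> 0"
    "\<And>a r. a \<in> A \<Longrightarrow> r < n' \<Longrightarrow> act (b r) a = (\<Sum>q<n'. fscale (\<rho>' a r q) (b q))"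
  proof (rule simple_right_submodule[of "{..<n} \<times> {..<d}" H h0 act])
    show "h i = 0" if "h \<in> H" "i \<notin> {..<n} \<times> {..<d}" for h i
      using that H0 by (cases i) (auto simp: not_less)
    show "act h (a \<cdot> b) = act (act h a) b" if "h \<in> H" "a \<in> A" "b \<in> A" for h a b
      by (rule row_eqI) (simp add: row_act mul_assoc rowA that)
    show "act h unit_elt = h" if "h \<in> H" for h
      by (rule row_eqI) (simp add: row_act mul_unit_right rowA that)
    show "act (h + h') a = act h a + act h' a" for h h' a
      by (rule row_eqI) (simp add: row_act row_add mul_add_left)
    show "act (fscale s h) a = fscale s (act h a)" for s h a
      by (rule row_eqI) (simp add: row_act row_scale mul_scale_left)
    show "act h (a + a') = act h a + act h a'" for h a a'
      by (rule row_eqI) (simp add: row_act row_add mul_add_right)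
    show "act h (fscale s a) = fscale s (act h a)" for h s a
      by (rule row_eqI) (simp add: row_act row_scale mul_scale_right)
  qed (use subH h0 \<open>h0 \<noteq> 0\<close> act_H in auto)
  \<comment> \<open>The value 0 keeps \<open>s\<close> inside A for indices at which
    \<open>b\<close> is arbitrary.\<close>
  define s where "s r r' = (if r' < n' then row (b r') r else 0)" for r r'
  have n': "n' > 0" using simple' by (simp add: simple_def)
  have "\<exists>r<n. s r 0 \<noteq> 0"
  proof (rule ccontr)
    assume "\<not> ?thesis"
    then have "row (b 0) r = row 0 r" for r
      using n' b(1)[OF n'] H0[of "b 0"] by (cases "r < n") (auto simp: s_def row_zero row_def fun_eq_iff)
    then have "b 0 = 0" by (rule row_eqI)
    then show False using b(2)[OF n'] by simp
  qed
  moreover have "s r r' \<cdot> a = (\<Sum>x<n'. fscale (\<rho>' a r' x) (s r x))" if "a \<in> A" "r' < n'" for a r r'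
  proof -
    have "s r r' \<cdot> a = row (act (b r') a) r" using that by (simp add: s_def row_act)
    then show ?thesis using that by (simp add: b(3) row_sum row_scale s_def)
  qed
  moreover have "a \<cdot> s r r' = (\<Sum>x<n. fscale (\<rho> a x r) (s x r'))" if "a \<in> A" "r < n" "r' < n'" for a r r'
    using row_hom[OF b(1)[OF that(3)] that(1,2)] that by (simp add: s_def)
  moreover have "s r r' \<in> A" for r r' using rowA[OF b(1)] by (auto simp: s_def)
  ultimately have "link n \<rho> n' \<rho>' s" unfolding link_def using n' by blast
  with simple' show thesis by (rule that)
qed

section \<open>Existence of a cycle of simple modules\<close>

lemma simple_exists:
  assumes "d > 0"
  obtains n \<rho> where "simple n \<rho>"
proof (rule simple_right_submodule[of "{..<d}" A "unit_fun 0" "\<lambda>h a. h \<cdot> a"])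
  show "fun_vs.subspace A" by (rule fun_vs.subspaceI) (auto simp: vecs_add vecs_scale)
  show "unit_fun 0 \<in> A" "unit_fun 0 \<noteq> (0 :: nat \<Rightarrow> 'k)"
    using assms by (simp_all add: vecs_unit_fun unit_fun_nonzero)
  show "h i = 0" if "h \<in> A" "i \<notin> {..<d}" for h i using that by (simp add: vecs_def)
qed (auto simp: mul_add_left mul_add_right mul_scale_left mul_scale_right mul_assoc mul_unit_right
    intro: that)

lemma rep_expand:
  assumes rep: "rep n \<rho>" and a: "a \<in> A" and r: "r < n" and q: "q < n"
  shows "\<rho> a r q = (\<Sum>i<d. a i * \<rho> (unit_fun i) r q)"
proof -
  have "mv n \<rho> (\<Sum>i<d. fscale (a i) (unit_fun i)) (unit_fun q)
      = (\<Sum>i<d. mv n \<rho> (fscale (a i) (unit_fun i)) (unit_fun q))"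
    by (rule mv_sum_left[OF rep]) (simp add: vecs_scale vecs_unit_fun)
  also have "\<dots> = (\<Sum>i<d. fscale (a i) (mv n \<rho> (unit_fun i) (unit_fun q)))"
    by (intro sum.cong refl mv_scale_left[OF rep]) (simp add: vecs_unit_fun)
  finally have "mv n \<rho> a (unit_fun q) = (\<Sum>i<d. fscale (a i) (mv n \<rho> (unit_fun i) (unit_fun q)))"
    by (simp only: vecs_expand[OF a, symmetric])
  then have "mv n \<rho> a (unit_fun q) r = (\<Sum>i<d. a i * mv n \<rho> (unit_fun i) (unit_fun q) r)"
    by (simp only: sum_fun_apply fscale_apply)
  then show ?thesis by (simp only: mv_unit_fun q r)
qed

text \<open>The (0, 0) matrix coefficients of d + 1 simple modules are linear forms on a space of
  dimension d, hence dependent. Were the modules pairwise non-isomorphic, this would contradict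
  \<open>matrix_coeffs_independent\<close>.\<close>

lemma similar_among:
  assumes k: "alg_closed TYPE('k)" and simple: "\<And>k. simple (n k) (\<rho> k)"
  obtains k l :: nat where "k \<noteq> l" "similar (n k) (\<rho> k) (n l) (\<rho> l)"
proof (rule ccontr)
  assume no: "\<not> thesis"
  note outer = that
  have nonsim: "\<not> similar (n k) (\<rho> k) (n l) (\<rho> l)" if "k \<noteq> l" for k l
    using no outer that by blast
  have n: "n k > 0" and rep: "rep (n k) (\<rho> k)" for k using simple[of k] by (auto simp: simple_def)
  define v where "v k = (\<lambda>i. if i < d then \<rho> k (unit_fun i) 0 0 else 0)" for k
  have v: "v k \<in> vecs d" for k by (simp add: v_def vecs_def)
  obtain t k0 where t: "k0 < Suc d" "t k0 \<noteq> 0" "(\<Sum>k<Suc d. fscale (t k) (v k)) = 0"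
    by (rule linear_relation[of d v, OF v]) (rule that)
  \<comment> \<open>With this \<open>g\<close> only the coefficient (0, 0) of each module takes part
    in the relation, with weight \<open>t k\<close>.\<close>
  define g where "g k q = (if q = 0 then fscale (t k) (unit_fun 0) else 0 :: nat \<Rightarrow> 'k)" for k q :: nat
  have "g k0 0 = 0"
  proof (rule matrix_coeffs_independent[OF k, of "Suc d" n \<rho> g])
    fix a assume a: "a \<in> A"
    have "(\<Sum>q<n k. mv (n k) (\<rho> k) a (g k q) q) = t k * \<rho> k a 0 0" for k
    proof -
      have "(\<Sum>q<n k. mv (n k) (\<rho> k) a (g k q) q) = (\<Sum>q<n k. if q = 0 then mv (n k) (\<rho> k) a (g k 0) 0 else 0)"
        by (intro sum.cong refl) (simp add: g_def)
      also have "\<dots> = t k * \<rho> k a 0 0"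
        using n[of k] by (simp add: g_def mv_scale_right mv_unit_fun)
      finally show ?thesis .
    qed
    moreover have "\<rho> k a 0 0 = (\<Sum>i<d. a i * v k i)" for k
      using rep_expand[OF rep a n n] by (simp add: v_def)
    ultimately have "(\<Sum>k<Suc d. \<Sum>q<n k. mv (n k) (\<rho> k) a (g k q) q) = (\<Sum>k<Suc d. \<Sum>i<d. a i * (t k * v k i))"
      by (simp only: sum_distrib_left mult.left_commute)
    also have "\<dots> = (\<Sum>i<d. a i * (\<Sum>k<Suc d. fscale (t k) (v k)) i)"
      by (subst sum.swap) (simp only: sum_fun_apply sum_distrib_left fscale_apply)
    also have "\<dots> = 0" unfolding t(3) by simp
    finally show "(\<Sum>k<Suc d. \<Sum>q<n k. mv (n k) (\<rho> k) a (g k q) q) = 0" .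
  qed (use simple nonsim n t(1) in \<open>auto simp: g_def vecs_scale vecs_unit_fun\<close>)
  then show False using t(2) by (simp add: g_def unit_fun_nonzero)
qed

text \<open>The map DA x V -> V' is followed by \<open>G\<close>. This closes the cycle, where the
  chain of modules returns to its start only up to isomorphism.\<close>

lemma link_compose:
  assumes link: "link n \<rho> n' \<rho>' s" and V': "simple n' \<rho>'"
    and G: "hom n' \<rho>' n'' \<rho>'' G" and x0: "x0 \<in> vecs n'" "G x0 \<noteq> 0"
  obtains s' where "link n \<rho> n'' \<rho>'' s'"
proof
  define s' where "s' r r'' = (\<Sum>p<n'. fscale (G (unit_fun p) r'') (s r p))" for r r''
  have G_matrix: "(\<Sum>p<n'. \<rho>' a p x * G (unit_fun p) r) = (\<Sum>y<n''. \<rho>'' a r y * G (unit_fun x) y)"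
    if a: "a \<in> A" and x: "x < n'" and r: "r < n''" for a x r
  proof -
    have "G (mv n' \<rho>' a (unit_fun x)) = (\<Sum>p<n'. fscale (mv n' \<rho>' a (unit_fun x) p) (G (unit_fun p)))"
      by (rule hom_expand[OF G]) simp
    then have "G (mv n' \<rho>' a (unit_fun x)) r = (\<Sum>p<n'. \<rho>' a p x * G (unit_fun p) r)"
      using x by (simp add: sum_fun_apply mv_unit_fun)
    moreover have "G (mv n' \<rho>' a (unit_fun x)) = mv n'' \<rho>'' a (G (unit_fun x))"
      using G a x by (simp add: hom_def vecs_unit_fun)
    ultimately show ?thesis using r by (simp add: mv_def)
  qed
  show "link n \<rho> n'' \<rho>'' s'"
    unfolding link_def
  proof (intro conjI allI ballI impI)
    show "s' r r'' \<in> A" for r r''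
      unfolding s'_def by (intro vecs_sum vecs_scale link_closed[OF link])
  next
    fix a r r'' assume a: "a \<in> A" and r: "r < n" and r'': "r'' < n''"
    have "(a \<cdot> s' r r'') j = (\<Sum>x<n. fscale (\<rho> a x r) (s' x r'')) j" for j
    proof -
      have "(a \<cdot> s' r r'') j = (\<Sum>p<n'. \<Sum>x<n. G (unit_fun p) r'' * (\<rho> a x r * s x p j))"
        using a r by (simp add: s'_def mul_sum_right mul_scale_right link_left[OF link] sum_fun_apply sum_distrib_left)
      also have "\<dots> = (\<Sum>x<n. \<rho> a x r * (\<Sum>p<n'. G (unit_fun p) r'' * s x p j))"
        by (subst sum.swap) (simp add: sum_distrib_left mult.left_commute)
      finally show ?thesis by (simp add: sum_fun_apply s'_def)
    qed
    then show "a \<cdot> s' r r'' = (\<Sum>x<n. fscale (\<rho> a x r) (s' x r''))" by (rule ext)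
    have "(s' r r'' \<cdot> a) j = (\<Sum>y<n''. fscale (\<rho>'' a r'' y) (s' r y)) j" for j
    proof -
      have "(s' r r'' \<cdot> a) j = (\<Sum>p<n'. \<Sum>x<n'. G (unit_fun p) r'' * (\<rho>' a p x * s r x j))"
        using a r by (simp add: s'_def mul_sum_left mul_scale_left link_right[OF link] sum_fun_apply sum_distrib_left)
      also have "\<dots> = (\<Sum>x<n'. (\<Sum>p<n'. \<rho>' a p x * G (unit_fun p) r'') * s r x j)"
        by (subst sum.swap) (simp add: sum_distrib_right mult.assoc mult.left_commute)
      also have "\<dots> = (\<Sum>x<n'. \<Sum>y<n''. \<rho>'' a r'' y * (G (unit_fun x) y * s r x j))"
        using a r'' by (simp add: G_matrix sum_distrib_right mult.assoc)
      also have "\<dots> = (\<Sum>y<n''. \<rho>'' a r'' y * (\<Sum>x<n'. G (unit_fun x) y * s r x j))"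
        by (subst sum.swap) (simp add: sum_distrib_left)
      finally show ?thesis by (simp add: sum_fun_apply s'_def)
    qed
    then show "s' r r'' \<cdot> a = (\<Sum>y<n''. fscale (\<rho>'' a r'' y) (s' r y))" by (rule ext)
  next
    obtain r r' where r: "r < n" "r' < n'" "s r r' \<noteq> 0" using link by (auto simp: link_def)
    then obtain j where j: "s r r' j \<noteq> 0" by (auto simp: fun_eq_iff)
    \<comment> \<open>\<open>x\<close> is the image in V' of the basis vector r under the dual basis
      element j. It is nonzero, so the injective map \<open>G\<close> does not kill it.\<close>
    define x where "x = (\<lambda>p. if p < n' then s r p j else 0)"
    have x: "x \<in> vecs n'" by (simp add: x_def vecs_def)
    have "x \<noteq> 0" using j r(2) by (auto simp: x_def fun_eq_iff)
    then have "G x \<noteq> 0" using hom_simple_inj[OF V' G x0 x] by blast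
    then obtain r'' where r'': "G x r'' \<noteq> 0" by (auto simp: fun_eq_iff)
    moreover have "G x \<in> vecs n''" using G x by (simp add: hom_def)
    ultimately have "r'' < n''" by (auto simp: vecs_def not_less[symmetric])
    moreover have "G x r'' = s' r r'' j"
      unfolding hom_expand[OF G x] by (simp add: sum_fun_apply s'_def x_def mult.commute)
    ultimately show "\<exists>r<n. \<exists>r''<n''. s' r r'' \<noteq> 0" using r(1) r'' by (metis zero_fun_apply)
  qed
qed

text \<open>The vectors of V killed by all of DA form a submodule, by \<open>link_left\<close>. It
  is not all of V because the link is nonzero, so by simplicity it is zero.\<close>

lemma link_nonzero:
  assumes link: "link n \<rho> n' \<rho>' s" and V: "simple n \<rho>" and x: "x \<in> vecs n" "x \<noteq> 0"
  obtains i r' where "i < d" "r' < n'" "(\<Sum>r<n. s r r' i * x r) \<noteq> 0"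
proof (rule ccontr)
  assume no: "\<not> thesis"
  note outer = that
  have zero: "(\<Sum>r<n. fscale (x r) (s r r')) = 0" if "r' < n'" for r'
  proof
    fix i
    show "(\<Sum>r<n. fscale (x r) (s r r')) i = 0 i"
    proof (cases "i < d")
      case True
      then have "(\<Sum>r<n. s r r' i * x r) = 0" using no outer that by blast
      then show ?thesis by (simp add: sum_fun_apply mult.commute)
    next
      case False
      then show ?thesis using link_closed[OF link] by (simp add: sum_fun_apply vecs_def)
    qed
  qed
  obtain r r' where r: "r < n" "r' < n'" "s r r' \<noteq> 0" using link by (auto simp: link_def)
  obtain a where a: "a \<in> A" "mv n \<rho> a x = unit_fun r"
    using simple_transitive[OF V x vecs_unit_fun[OF r(1)]] .
  have "s r r' i = 0" for i
  proof -
    have "s r r' i = (\<Sum>p<n. mv n \<rho> a x p * s p r' i)"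
      using r(1) by (simp add: a(2) unit_fun_def if_distrib[of "\<lambda>t. t * _"] cong: if_cong)
    also have "\<dots> = (\<Sum>p<n. \<Sum>q<n. x q * (\<rho> a p q * s p r' i))"
      by (simp add: mv_def sum_distrib_right sum_distrib_left mult.assoc mult.left_commute)
    also have "\<dots> = (\<Sum>q<n. x q * (a \<cdot> s q r') i)"
      by (subst sum.swap) (simp add: link_left[OF link a(1) _ r(2)] sum_fun_apply sum_distrib_left)
    also have "\<dots> = (a \<cdot> (\<Sum>q<n. fscale (x q) (s q r'))) i"
      by (simp add: mul_sum_right mul_scale_right sum_fun_apply)
    finally show ?thesis unfolding zero[OF r(2)] by simp
  qed
  then show False using r(3) by (simp add: fun_eq_iff)
qed

text \<open>In an infinite chain of linked simple modules take two isomorphic ones at least possible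
  distance L. Among the L modules that start at the first of them no two are isomorphic, as they
  would be closer together. The last link is composed with the isomorphism back to the
  start.\<close>

lemma cycle_exists:
  assumes k: "alg_closed TYPE('k)" and d: "d > 0" and inj: "selfinjective d c"
  obtains L :: nat and n \<rho> \<sigma> where "L > 0" "\<And>k. k < L \<Longrightarrow> simple (n k) (\<rho> k)"
    "\<And>k l. k < L \<Longrightarrow> l < L \<Longrightarrow> k \<noteq> l \<Longrightarrow> \<not> similar (n k) (\<rho> k) (n l) (\<rho> l)"
    "\<And>k. k < L \<Longrightarrow> link (n k) (\<rho> k) (n (Suc k mod L)) (\<rho> (Suc k mod L)) (\<sigma> k)"
proof -
  define simp' where "simp' V = (case V of (n, \<rho>) \<Rightarrow> simple n \<rho>)" for V
  define link' where "link' V V' = (case V of (n, \<rho>) \<Rightarrow> case V' of (n', \<rho>') \<Rightarrow> \<exists>s. link n \<rho> n' \<rho>' s)" for V V'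
  have "\<exists>V. \<forall>k. simp' (V k) \<and> link' (V k) (V (Suc k))"
  proof (rule dependent_nat_choice)
    obtain n \<rho> where "simple n \<rho>" using simple_exists[OF d] .
    then show "\<exists>V. simp' V" by (intro exI[of _ "(n, \<rho>)"]) (simp add: simp'_def)
    fix V :: "nat \<times> ((nat \<Rightarrow> 'k) \<Rightarrow> nat \<Rightarrow> nat \<Rightarrow> 'k)"
    assume "simp' V"
    then obtain n \<rho> where V: "V = (n, \<rho>)" "simple n \<rho>" by (cases V) (auto simp: simp'_def)
    obtain n' \<rho>' s where "simple n' \<rho>'" "link n \<rho> n' \<rho>' s"
      by (rule next_simple[OF inj V(2)])
    then show "\<exists>V'. simp' V' \<and> link' V V'"
      by (intro exI[of _ "(n', \<rho>')"]) (auto simp: simp'_def link'_def V)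
  qed
  then obtain V where V: "\<And>k. simp' (V k)" "\<And>k. link' (V k) (V (Suc k))" by blast
  define m where "m k = fst (V k)" for k
  define \<tau> where "\<tau> k = snd (V k)" for k
  have simple: "simple (m k) (\<tau> k)" for k
    using V(1)[of k] by (simp add: simp'_def m_def \<tau>_def split_def)
  have link: "\<exists>s. link (m k) (\<tau> k) (m (Suc k)) (\<tau> (Suc k)) s" for k
    using V(2)[of k] by (simp add: link'_def m_def \<tau>_def split_def)
  define sim where "sim k l = similar (m k) (\<tau> k) (m l) (\<tau> l)" for k l
  have sim_sym: "sim k l \<Longrightarrow> sim l k" for k l
    unfolding sim_def by (rule similar_sym[OF simple simple])
  obtain a b where "a \<noteq> b" "sim a b"
    unfolding sim_def by (rule similar_among[OF k, of m \<tau>]) (rule simple)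
  then have "\<exists>L. L > 0 \<and> (\<exists>i. sim i (i + L))"
    using sim_sym by (metis less_imp_add_positive linorder_neqE_nat)
  define L where "L = (LEAST L. L > 0 \<and> (\<exists>i. sim i (i + L)))"
  have L: "L > 0" "\<exists>i. sim i (i + L)" and L_le: "\<And>L' i. L' > 0 \<Longrightarrow> sim i (i + L') \<Longrightarrow> L \<le> L'"
    using LeastI_ex[OF \<open>\<exists>L. L > 0 \<and> (\<exists>i. sim i (i + L))\<close>] Least_le[of "\<lambda>L. L > 0 \<and> (\<exists>i. sim i (i + L))"]
    unfolding L_def by blast+
  obtain i where i: "sim (i + L) i" using L(2) sim_sym by blast
  define n where "n k = m (i + k)" for k
  define \<rho> where "\<rho> k = \<tau> (i + k)" for k
  have nonsim_less: "\<not> sim (i + k) (i + l)" if "k < l" "l < L" for k l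
    using L_le[of "l - k" "i + k"] that by auto
  have nonsim: "\<not> similar (n k) (\<rho> k) (n l) (\<rho> l)" if "k < L" "l < L" "k \<noteq> l" for k l
    using nonsim_less[of k l] nonsim_less[of l k] sim_sym that
    unfolding n_def \<rho>_def sim_def[symmetric] by (metis linorder_neqE_nat)
  have "\<exists>s. link (n k) (\<rho> k) (n (Suc k mod L)) (\<rho> (Suc k mod L)) s" if "k < L" for k
  proof (cases "Suc k = L")
    case False
    then show ?thesis using link[of "i + k"] that by (simp add: n_def \<rho>_def)
  next
    case True
    obtain G x0 where G: "hom (m (i + L)) (\<tau> (i + L)) (m i) (\<tau> i) G" "x0 \<in> vecs (m (i + L))" "G x0 \<noteq> 0"
      using i by (auto simp: sim_def similar_def)
    obtain s where s: "link (m (i + k)) (\<tau> (i + k)) (m (i + L)) (\<tau> (i + L)) s"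
      using link[of "i + k"] True by auto
    show ?thesis using link_compose[OF s simple G] True by (auto simp: n_def \<rho>_def)
  qed
  then obtain \<sigma> where "\<And>k. k < L \<Longrightarrow> link (n k) (\<rho> k) (n (Suc k mod L)) (\<rho> (Suc k mod L)) (\<sigma> k)"
    by metis
  then show thesis using that[of L n \<rho> \<sigma>] L(1) simple nonsim by (simp add: n_def \<rho>_def)
qed

end

section \<open>The cochain of a cycle of simple modules\<close>

lemma minus_one_power_parity: "even m = even n \<Longrightarrow> (- 1 :: 'k::ring_1) ^ m = (- 1) ^ n"
  by (cases "even m") (auto simp: minus_one_power_iff)

locale module_cycle = unital_algebra d c
  for d :: nat and c :: "nat \<Rightarrow> nat \<Rightarrow> nat \<Rightarrow> 'k::field" +
  fixes L :: nat and n :: "nat \<Rightarrow> nat" and \<rho> :: "nat \<Rightarrow> (nat \<Rightarrow> 'k) \<Rightarrow> nat \<Rightarrow> nat \<Rightarrow> 'k"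
    and \<sigma> :: "nat \<Rightarrow> nat \<Rightarrow> nat \<Rightarrow> nat \<Rightarrow> 'k"
  assumes alg_closed: "alg_closed TYPE('k)" and L: "L > 0"
    and simple: "\<And>k. k < L \<Longrightarrow> simple (n k) (\<rho> k)"
    and nonsim: "\<And>k l. k < L \<Longrightarrow> l < L \<Longrightarrow> k \<noteq> l \<Longrightarrow> \<not> similar (n k) (\<rho> k) (n l) (\<rho> l)"
    and link: "\<And>k. k < L \<Longrightarrow> link (n k) (\<rho> k) (n (Suc k mod L)) (\<rho> (Suc k mod L)) (\<sigma> k)"
begin

text \<open>Indices of a basis of X, the direct sum of the V_k.\<close>

definition J :: "(nat \<times> nat) set" where
  "J = Sigma {..<L} (\<lambda>k. {..<n k})"

definition \<delta> :: 'k where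
  "\<delta> = (- 1) ^ (L - 1)"

definition R :: "nat \<Rightarrow> nat \<times> nat \<Rightarrow> nat \<times> nat \<Rightarrow> 'k" where
  "R i = (\<lambda>(k', r') (k, r). if i < d \<and> (k', r') \<in> J \<and> (k, r) \<in> J \<and> k' = k then \<rho> k (unit_fun i) r' r else 0)"

text \<open>The matrix of the operator of the dual basis element \<open>i - d\<close>. Rows lie in
  V_(k+1) and columns in V_k, hence the exchanged order of \<open>r\<close> and \<open>r'\<close> in
  \<open>\<sigma>\<close>.\<close>

definition N :: "nat \<Rightarrow> nat \<times> nat \<Rightarrow> nat \<times> nat \<Rightarrow> 'k" where
  "N i = (\<lambda>(k', r') (k, r). if d \<le> i \<and> i < 2 * d \<and> (k', r') \<in> J \<and> (k, r) \<in> J \<and> k' = Suc k mod L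
     then \<sigma> k r r' (i - d) else 0)"

text \<open>The signs make the trace cyclic up to the sign of the cyclic operator; they close up along the
  cycle because \<open>\<delta> ^ L = 1\<close>.\<close>

definition D :: "nat \<times> nat \<Rightarrow> nat \<times> nat \<Rightarrow> 'k" where
  "D x y = (if x = y then \<delta> ^ fst x else 0)"

lemma finite_J [simp]: "finite J"
  by (simp add: J_def)

lemma J_iff: "(k, r) \<in> J \<longleftrightarrow> k < L \<and> r < n k"
  by (simp add: J_def)

lemma sum_J_block:
  assumes "k < L" "\<And>l q. (l, q) \<in> J \<Longrightarrow> l \<noteq> k \<Longrightarrow> f (l, q) = 0"
  shows "(\<Sum>y\<in>J. f y) = (\<Sum>q<n k. f (k, q) :: 'k)"
proof -
  have out: "f y = 0" if y: "y \<in> J - Pair k ` {..<n k}" for y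
  proof -
    obtain l q where lq: "y = (l, q)" by (cases y)
    with y have "l \<noteq> k" by (auto simp: J_iff)
    then show ?thesis using assms(2)[of l q] y lq by simp
  qed
  have "(\<Sum>y\<in>J. f y) = (\<Sum>y\<in>Pair k ` {..<n k}. f y)"
    by (rule sum.mono_neutral_right[OF finite_J]) (use assms(1) out in \<open>auto simp: J_iff\<close>)
  also have "\<dots> = (\<Sum>q<n k. f (k, q))" by (subst sum.reindex) (auto simp: inj_on_def)
  finally show ?thesis .
qed

lemma Suc_mod_less: "Suc k mod L < L"
  using L by simp

lemma Suc_mod_inj: "k < L \<Longrightarrow> l < L \<Longrightarrow> Suc k mod L = Suc l mod L \<Longrightarrow> k = l"
  by (cases "Suc k = L"; cases "Suc l = L") auto

lemma R_outside: "x \<notin> J \<or> z \<notin> J \<Longrightarrow> R i x z = 0"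
  and N_outside: "x \<notin> J \<or> z \<notin> J \<Longrightarrow> N i x z = 0"
  by (cases x; cases z; auto simp: R_def N_def)+

lemma R_block: "fst x \<noteq> fst z \<Longrightarrow> R i x z = 0"
  and N_block: "fst x \<noteq> Suc (fst z) mod L \<Longrightarrow> N i x z = 0"
  by (cases x; cases z; auto simp: R_def N_def)+

lemma R_nonzeroD: "R i x z \<noteq> 0 \<Longrightarrow> x \<in> J \<and> z \<in> J \<and> fst x = fst z"
  and N_nonzeroD: "N i x z \<noteq> 0 \<Longrightarrow> x \<in> J \<and> z \<in> J \<and> fst x = Suc (fst z) mod L"
  using R_outside R_block N_outside N_block by blast+

lemma mat_trace_J: "mat_trace J M = (\<Sum>k<L. \<Sum>q<n k. M (k, q) (k, q))"
  by (simp add: mat_trace_def J_def sum.Sigma split_def)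

text \<open>This is the linearity a [f] = [a f] of the link, in coordinates; \<open>N_R\<close> is
  the balancedness [f] a = [f a].\<close>

lemma R_N:
  assumes "i < d" "d \<le> j" "j < 2 * d" "(Suc k mod L, r') \<in> J" "(k, r) \<in> J"
  shows "mat_mul J (R i) (N j) (Suc k mod L, r') (k, r) = (\<sigma> k r r' \<cdot> unit_fun i) (j - d)"
proof -
  have k: "k < L" "r < n k" "r' < n (Suc k mod L)" using assms(4,5) by (auto simp: J_iff)
  have "mat_mul J (R i) (N j) (Suc k mod L, r') (k, r)
      = (\<Sum>q<n (Suc k mod L). R i (Suc k mod L, r') (Suc k mod L, q) * N j (Suc k mod L, q) (k, r))"
    unfolding mat_mul_def by (rule sum_J_block[OF Suc_mod_less]) (simp add: R_block)
  also have "\<dots> = (\<Sum>q<n (Suc k mod L). \<rho> (Suc k mod L) (unit_fun i) r' q * \<sigma> k r q (j - d))"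
    by (intro sum.cong refl) (use assms in \<open>simp add: R_def N_def J_iff\<close>)
  also have "\<dots> = (\<sigma> k r r' \<cdot> unit_fun i) (j - d)"
    using link_right[OF link[OF k(1)] vecs_unit_fun[OF assms(1)] k(2,3)] by (simp add: sum_fun_apply)
  finally show ?thesis .
qed

lemma N_R:
  assumes "j < d" "d \<le> i" "i < 2 * d" "(Suc k mod L, r') \<in> J" "(k, r) \<in> J"
  shows "mat_mul J (N i) (R j) (Suc k mod L, r') (k, r) = (unit_fun j \<cdot> \<sigma> k r r') (i - d)"
proof -
  have k: "k < L" "r < n k" "r' < n (Suc k mod L)" using assms(4,5) by (auto simp: J_iff)
  have "mat_mul J (N i) (R j) (Suc k mod L, r') (k, r)
      = (\<Sum>q<n k. N i (Suc k mod L, r') (k, q) * R j (k, q) (k, r))"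
    unfolding mat_mul_def by (rule sum_J_block[OF k(1)]) (simp add: R_block)
  also have "\<dots> = (\<Sum>q<n k. \<rho> k (unit_fun j) q r * \<sigma> k q r' (i - d))"
    by (intro sum.cong refl) (use assms in \<open>simp add: R_def N_def J_iff\<close>)
  also have "\<dots> = (unit_fun j \<cdot> \<sigma> k r r') (i - d)"
    using link_left[OF link[OF k(1)] vecs_unit_fun[OF assms(1)] k(2,3)] by (simp add: sum_fun_apply)
  finally show ?thesis .
qed

lemma R_zero: "d \<le> i \<Longrightarrow> R i x z = 0"
  and N_zero: "i < d \<Longrightarrow> N i x z = 0"
  by (cases x; cases z; simp add: R_def N_def)+

lemma sum_N:
  assumes "(Suc k mod L, r') \<in> J" "(k, r) \<in> J"
  shows "(\<Sum>l<2 * d. f l * N l (Suc k mod L, r') (k, r)) = (\<Sum>m<d. f (d + m) * \<sigma> k r r' m)"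
proof -
  have "(\<Sum>l<2 * d. f l * N l (Suc k mod L, r') (k, r))
      = (\<Sum>l\<in>(+) d ` {..<d}. f l * N l (Suc k mod L, r') (k, r))"
  proof (rule sum.mono_neutral_right)
    show "\<forall>l\<in>{..<2 * d} - (+) d ` {..<d}. f l * N l (Suc k mod L, r') (k, r) = 0"
    proof
      fix l assume l: "l \<in> {..<2 * d} - (+) d ` {..<d}"
      have "l < d"
      proof (rule ccontr)
        assume "\<not> l < d"
        then have "l = d + (l - d)" "l - d < d" using l by auto
        then show False using l by blast
      qed
      then show "f l * N l (Suc k mod L, r') (k, r) = 0" by (simp add: N_zero)
    qed
  qed auto
  also have "\<dots> = (\<Sum>m<d. f (d + m) * N (d + m) (Suc k mod L, r') (k, r))"
    by (subst sum.reindex) auto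
  also have "\<dots> = (\<Sum>m<d. f (d + m) * \<sigma> k r r' m)"
    by (intro sum.cong refl) (use assms in \<open>simp add: N_def\<close>)
  finally show ?thesis .
qed

text \<open>A product of two elements of A has no component in DA and a product of two elements of
  DA is zero, so in both cases all terms vanish. The mixed products are the two identities of the
  link.\<close>

lemma N_derivation:
  assumes i: "i < 2 * d" and j: "j < 2 * d"
  shows "(\<Sum>l<2 * d. triv_ext d c i j l * N l x z) = mat_mul J (R i) (N j) x z + mat_mul J (N i) (R j) x z"
proof (cases "x \<in> J \<and> z \<in> J \<and> fst x = Suc (fst z) mod L")
  case False
  have prod_zero: "R i x y * N j y z = 0" "N i x y * R j y z = 0" for y
    using False R_nonzeroD[of i x y] N_nonzeroD[of j y z] R_nonzeroD[of j y z] N_nonzeroD[of i x y]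
    unfolding mult_eq_0_iff by metis+
  have "N l x z = 0" for l using False N_nonzeroD[of l x z] by metis
  then show ?thesis by (simp add: mat_mul_def prod_zero del: mult_eq_0_iff)
next
  case True
  obtain k r where z: "z = (k, r)" by (cases z)
  obtain r' where x: "x = (Suc k mod L, r')" using True z by (cases x) auto
  have J: "(Suc k mod L, r') \<in> J" "(k, r) \<in> J" using True x z by auto
  have s: "\<sigma> k r r' \<in> A" using link_closed[OF link] J by (simp add: J_iff)
  show ?thesis
  proof (cases "i < d"; cases "j < d")
    assume "i < d" "j < d"
    then show ?thesis using J by (simp add: x z sum_N mat_mul_def N_zero triv_ext_def)
  next
    assume ij: "i < d" "\<not> j < d"
    have "mat_mul J (N i) (R j) x z = 0" using ij by (simp add: mat_mul_def N_zero)
    moreover have "mat_mul J (R i) (N j) x z = (\<Sum>m<d. c m i (j - d) * \<sigma> k r r' m)"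
      using ij j by (simp add: x z R_N[OF _ _ _ J] mul_unit_right_coeff s)
    ultimately show ?thesis using ij j by (simp add: x z sum_N[OF J] triv_ext_def)
  next
    assume ij: "\<not> i < d" "j < d"
    have "mat_mul J (R i) (N j) x z = 0" using ij by (simp add: mat_mul_def R_zero)
    moreover have "mat_mul J (N i) (R j) x z = (\<Sum>m<d. c j m (i - d) * \<sigma> k r r' m)"
      using ij i by (simp add: x z N_R[OF _ _ _ J] mul_unit_left_coeff s)
    ultimately show ?thesis using ij i by (simp add: x z sum_N[OF J] triv_ext_def)
  next
    assume "\<not> i < d" "\<not> j < d"
    then show ?thesis using J by (simp add: x z sum_N mat_mul_def R_zero triv_ext_def)
  qed
qed

lemma mat_mul_D_left: "(x \<notin> J \<Longrightarrow> M x z = 0) \<Longrightarrow> mat_mul J D M x z = \<delta> ^ fst x * M x z"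
  and mat_mul_D_right: "(z \<notin> J \<Longrightarrow> M x z = 0) \<Longrightarrow> mat_mul J M D x z = M x z * \<delta> ^ fst z"
  by (cases "x \<in> J"; cases "z \<in> J";
      simp add: mat_mul_def D_def if_distrib[of "\<lambda>t. t * _"] if_distrib[of "\<lambda>t. _ * t"] cong: if_cong)+

text \<open>The only critical step is the one from V_(L-1) back to V_0, where L (L-1) being even is
  used.\<close>

lemma \<delta>_power_Suc_mod:
  assumes "k < L"
  shows "\<delta> ^ (Suc k mod L) = \<delta> * \<delta> ^ k"
proof (cases "Suc k = L")
  case True
  have "\<delta> * \<delta> ^ k = \<delta> ^ L" by (simp flip: True)
  also have "\<dots> = (- 1) ^ ((L - 1) * L)" by (simp only: \<delta>_def power_mult)
  also have "\<dots> = 1" using L by (auto simp: minus_one_power_iff)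
  finally show ?thesis using True by simp
next
  case False
  then show ?thesis using assms by simp
qed

sublocale cyclic_trace J "2 * d" "triv_ext d c" R N D \<delta>
proof
  fix i j assume "i < 2 * d" "j < 2 * d"
  then show "(\<lambda>x z. \<Sum>l<2 * d. triv_ext d c i j l * N l x z)
      = (\<lambda>x z. mat_mul J (R i) (N j) x z + mat_mul J (N i) (R j) x z)"
    by (intro ext N_derivation)
next
  fix i
  show "mat_mul J D (R i) = mat_mul J (R i) D"
  proof (intro ext)
    fix x z
    show "mat_mul J D (R i) x z = mat_mul J (R i) D x z"
      by (cases "fst x = fst z") (simp_all add: mat_mul_D_left mat_mul_D_right R_outside R_block mult.commute)
  qed
  show "mat_mul J D (N i) = (\<lambda>x z. \<delta> * mat_mul J (N i) D x z)"
  proof (intro ext)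
    fix x z
    have "\<delta> ^ fst x = \<delta> * \<delta> ^ fst z" if "N i x z \<noteq> 0"
      using N_nonzeroD[OF that] \<delta>_power_Suc_mod[of "fst z"] by (cases z) (auto simp: J_iff)
    then show "mat_mul J D (N i) x z = \<delta> * mat_mul J (N i) D x z"
      by (cases "N i x z = 0") (simp_all add: mat_mul_D_left mat_mul_D_right N_outside mult.commute mult.left_commute)
  qed
qed

section \<open>Nonvanishing of the trace\<close>

definition N_prod :: "nat list \<Rightarrow> nat \<times> nat \<Rightarrow> nat \<times> nat \<Rightarrow> 'k" where
  "N_prod u = foldl (mat_mul J) (N (hd u)) (map N (tl u))"

lemma N_prod_Cons: "u \<noteq> [] \<Longrightarrow> N_prod (j # u) = mat_mul J (N j) (N_prod u)"
  by (cases u) (simp_all add: N_prod_def foldl_mat_mul)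

text \<open>By \<open>link_nonzero\<close> each further letter can be chosen so that the image of
  \<open>x\<close> stays nonzero. New letters are put in front, since the last letter of a word acts
  first.\<close>

lemma N_prod_nonzero:
  assumes k: "k < L" and x: "x \<in> vecs (n k)" "x \<noteq> 0"
  shows "\<exists>u y. length u = Suc l \<and> set u \<subseteq> {d..<2 * d} \<and> y \<in> vecs (n ((k + Suc l) mod L)) \<and> y \<noteq> 0 \<and>
    (\<forall>r'<n ((k + Suc l) mod L). y r' = (\<Sum>r<n k. N_prod u ((k + Suc l) mod L, r') (k, r) * x r))"
proof (induction l)
  case 0
  obtain i r0 where i: "i < d" "r0 < n (Suc k mod L)" "(\<Sum>r<n k. \<sigma> k r r0 i * x r) \<noteq> 0"
    by (rule link_nonzero[OF link[OF k] simple[OF k] x])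
  define y where "y = (\<lambda>r'. if r' < n (Suc k mod L) then \<Sum>r<n k. \<sigma> k r r' i * x r else 0)"
  have "y r0 \<noteq> 0" using i by (simp add: y_def)
  then have y0: "y \<noteq> 0" by (auto simp: fun_eq_iff)
  have y_eq: "y r' = (\<Sum>r<n k. N_prod [d + i] (Suc k mod L, r') (k, r) * x r)" if "r' < n (Suc k mod L)" for r'
    using that k i(1) Suc_mod_less by (simp add: y_def N_prod_def N_def J_iff)
  have yv: "y \<in> vecs (n (Suc k mod L))" by (simp add: y_def vecs_def)
  show ?case
  proof (intro exI conjI)
    show "length [d + i] = Suc 0" by simp
    show "y \<noteq> 0" by (rule y0)
  qed (use i(1) y_eq yv in auto)
next
  case (Suc l)
  define k' where "k' = (k + Suc l) mod L"
  have k': "k' < L" "(k + Suc (Suc l)) mod L = Suc k' mod L" using L by (simp_all add: k'_def mod_Suc_eq)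
  obtain u y where u: "length u = Suc l" "set u \<subseteq> {d..<2 * d}" and y: "y \<in> vecs (n k')" "y \<noteq> 0"
    and yu: "\<And>r'. r' < n k' \<Longrightarrow> y r' = (\<Sum>r<n k. N_prod u (k', r') (k, r) * x r)"
    using Suc.IH unfolding k'_def by blast
  obtain i r0 where i: "i < d" "r0 < n (Suc k' mod L)" "(\<Sum>r<n k'. \<sigma> k' r r0 i * y r) \<noteq> 0"
    by (rule link_nonzero[OF link[OF k'(1)] simple[OF k'(1)] y])
  define w where "w = (\<lambda>r'. if r' < n (Suc k' mod L) then \<Sum>r<n k'. \<sigma> k' r r' i * y r else 0)"
  have "w r0 \<noteq> 0" using i by (simp add: w_def)
  then have w0: "w \<noteq> 0" by (auto simp: fun_eq_iff)
  have w_eq: "w r' = (\<Sum>r<n k. N_prod ((d + i) # u) (Suc k' mod L, r') (k, r) * x r)"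
    if r': "r' < n (Suc k' mod L)" for r'
  proof -
    have step: "N_prod ((d + i) # u) (Suc k' mod L, r') z = (\<Sum>q<n k'. \<sigma> k' q r' i * N_prod u (k', q) z)" for z
    proof -
      have "N_prod ((d + i) # u) (Suc k' mod L, r') z
          = (\<Sum>y\<in>J. N (d + i) (Suc k' mod L, r') y * N_prod u y z)"
      proof -
        have "u \<noteq> []" using u(1) by auto
        then show ?thesis using N_prod_Cons[of u "d + i"] by (simp add: mat_mul_def)
      qed
      also have "\<dots> = (\<Sum>q<n k'. N (d + i) (Suc k' mod L, r') (k', q) * N_prod u (k', q) z)"
      proof (rule sum_J_block[OF k'(1)])
        fix l q assume "(l, q) \<in> J" "l \<noteq> k'"
        then have "Suc k' mod L \<noteq> Suc l mod L" using Suc_mod_inj[of k' l] k'(1) by (auto simp: J_iff)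
        then show "N (d + i) (Suc k' mod L, r') (l, q) * N_prod u (l, q) z = 0" by (simp add: N_block)
      qed
      also have "\<dots> = (\<Sum>q<n k'. \<sigma> k' q r' i * N_prod u (k', q) z)"
        by (intro sum.cong refl) (use r' k'(1) i(1) Suc_mod_less in \<open>simp add: N_def J_iff\<close>)
      finally show ?thesis .
    qed
    have "w r' = (\<Sum>q<n k'. \<Sum>r<n k. \<sigma> k' q r' i * (N_prod u (k', q) (k, r) * x r))"
      using r' by (simp add: w_def yu sum_distrib_left)
    also have "\<dots> = (\<Sum>r<n k. N_prod ((d + i) # u) (Suc k' mod L, r') (k, r) * x r)"
      unfolding step by (subst sum.swap) (simp add: sum_distrib_right mult.assoc)
    finally show ?thesis .
  qed
  have wv: "w \<in> vecs (n (Suc k' mod L))" by (simp add: w_def vecs_def)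
  show ?case
    unfolding k'(2)
  proof (intro exI conjI)
    show "length ((d + i) # u) = Suc (Suc l)" using u(1) by simp
    show "w \<noteq> 0" by (rule w0)
  qed (use u(2) i(1) w_eq wv in auto)
qed

text \<open>If the trace vanished on all words \<open>j # us\<close>, then by multiplying the first letter with elements
  \<open>a\<close> of \<open>A\<close> one would get a linear relation between the matrix coefficients of the pairwise
  non-isomorphic modules, with the diagonal blocks of \<open>N_prod (j # us)\<close> as coefficients.\<close>

lemma tr_cochain_nonzero:
  assumes w: "w > 0" "L dvd w"
  obtains u where "length u = w" "set u \<subseteq> {d..<2 * d}" "tr_cochain u \<noteq> 0"
proof (rule ccontr)
  assume no: "\<not> thesis"
  note outer = that
  have zero: "tr_cochain u = 0" if "length u = w" "set u \<subseteq> {d..<2 * d}" for u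
    using no outer that by blast
  have n0: "n 0 > 0" using simple[OF L] by (simp add: simple_def)
  \<comment> \<open>Since \<open>L\<close> divides \<open>w\<close>, a word of \<open>w\<close>
    letters leads from V_0 back to V_0; the shift accounts for the length \<open>Suc l\<close> in
    \<open>N_prod_nonzero\<close>.\<close>
  have mod: "(0 + Suc (w - 1)) mod L = 0" using w by (simp add: dvd_eq_mod_eq_0)
  obtain u y where u: "length u = w" "set u \<subseteq> {d..<2 * d}" and y: "y \<in> vecs (n 0)" "y \<noteq> 0"
    and yu: "\<And>r'. r' < n 0 \<Longrightarrow> y r' = (\<Sum>r<n 0. N_prod u (0, r') (0, r) * unit_fun 0 r)"
    using N_prod_nonzero[OF L vecs_unit_fun[OF n0] unit_fun_nonzero, of "w - 1"] w(1) unfolding mod by auto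
  obtain j us where ju: "u = j # us" using u(1) w(1) by (cases u) auto
  have j: "d \<le> j" "j < 2 * d" and us: "set us \<subseteq> {d..<2 * d}" using u(2) ju by auto
  define Q where "Q = N_prod u"
  \<comment> \<open>The product of the basis element i of A with the first letter is a combination
    of letters in DA, so the trace vanishes on the resulting words. The term with \<open>N i\<close>
    drops out because \<open>N\<close> kills A.\<close>
  have tr: "mat_trace J (mat_mul J (mat_mul J D (R i)) Q) = 0" if i: "i < d" for i
  proof -
    have "(\<Sum>l<2 * d. triv_ext d c i j l * trace_prod J D (N l # map N us))
      = trace_prod J (mat_mul J D (R i)) (N j # map N us)
        + trace_prod J (mat_mul J (mat_mul J D (N i)) (R j)) (map N us)"
      using i j by (intro trace_prod_merge) auto
    also have "trace_prod J (mat_mul J (mat_mul J D (N i)) (R j)) (map N us) = 0"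
    proof -
      have "mat_mul J (mat_mul J D (N i)) (R j) = (\<lambda>x z. 0 * R j x z)"
        using i by (simp add: mat_mul_def N_zero)
      then show ?thesis by (simp only: trace_prod_scale) simp
    qed
    also have "trace_prod J (mat_mul J D (R i)) (N j # map N us) = mat_trace J (mat_mul J (mat_mul J D (R i)) Q)"
      by (simp add: trace_prod_def foldl_mat_mul Q_def N_prod_def ju)
    also have "(\<Sum>l<2 * d. triv_ext d c i j l * trace_prod J D (N l # map N us)) = 0"
    proof (intro sum.neutral ballI)
      fix l assume l: "l \<in> {..<2 * d}"
      show "triv_ext d c i j l * trace_prod J D (N l # map N us) = 0"
      proof (cases "d \<le> l")
        case True
        then have "tr_cochain (l # us) = 0" using l us u(1) ju by (intro zero) auto
        then show ?thesis by (simp add: tr_cochain_def)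
      next
        case False
        then show ?thesis using i j by (simp add: triv_ext_def)
      qed
    qed
    finally show ?thesis by simp
  qed
  \<comment> \<open>\<open>g k q r\<close> is the factor of the matrix coefficient (q, r) of V_k in
    this trace; the power of \<delta> comes from \<open>D\<close>.\<close>
  define g where "g k q = (\<lambda>r. if r < n k then \<delta> ^ k * Q (k, r) (k, q) else 0)" for k q
  have tr_coeffs: "(\<Sum>k<L. \<Sum>q<n k. \<Sum>r<n k. \<rho> k (unit_fun i) q r * g k q r) = 0" if i: "i < d" for i
  proof -
    have "mat_mul J (mat_mul J D (R i)) Q (k, q) (k, q) = (\<Sum>r<n k. \<rho> k (unit_fun i) q r * g k q r)"
      if k: "k < L" "q < n k" for k q
    proof -
      have "mat_mul J (mat_mul J D (R i)) Q (k, q) (k, q)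
          = (\<Sum>r<n k. mat_mul J D (R i) (k, q) (k, r) * Q (k, r) (k, q))"
        unfolding mat_mul_def[of J "mat_mul J D (R i)"]
        by (rule sum_J_block[OF k(1)]) (simp add: mat_mul_D_left R_outside R_block)
      also have "\<dots> = (\<Sum>r<n k. \<rho> k (unit_fun i) q r * g k q r)"
        using k i by (intro sum.cong refl)
          (simp add: mat_mul_D_left R_outside g_def, simp add: R_def J_iff mult.commute mult.left_commute)
      finally show ?thesis .
    qed
    then have "mat_trace J (mat_mul J (mat_mul J D (R i)) Q)
        = (\<Sum>k<L. \<Sum>q<n k. \<Sum>r<n k. \<rho> k (unit_fun i) q r * g k q r)"
      by (simp add: mat_trace_J)
    then show ?thesis using tr[OF i] by simp
  qed
  have "g 0 0 = 0"
  proof (rule matrix_coeffs_independent[OF alg_closed simple nonsim, of L "\<lambda>k. k" g])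
    fix a assume a: "a \<in> A"
    have "(\<Sum>k<L. \<Sum>q<n k. mv (n k) (\<rho> k) a (g k q) q)
      = (\<Sum>k<L. \<Sum>q<n k. \<Sum>r<n k. \<Sum>i<d. a i * (\<rho> k (unit_fun i) q r * g k q r))"
      by (intro sum.cong refl)
        (simp add: mv_def rep_expand[OF simple_rep[OF simple] a] sum_distrib_right mult.assoc)
    also have "\<dots> = (\<Sum>i<d. \<Sum>k<L. \<Sum>q<n k. \<Sum>r<n k. a i * (\<rho> k (unit_fun i) q r * g k q r))"
      by (simp only: sum.swap[of _ "{..<d}"])
    also have "\<dots> = (\<Sum>i<d. a i * (\<Sum>k<L. \<Sum>q<n k. \<Sum>r<n k. \<rho> k (unit_fun i) q r * g k q r))"
      by (simp only: sum_distrib_left)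
    also have "\<dots> = 0" by (simp add: tr_coeffs)
    finally show "(\<Sum>k<L. \<Sum>q<n k. mv (n k) (\<rho> k) a (g k q) q) = 0" .
  qed (use n0 L in \<open>auto simp: g_def vecs_def\<close>)
  then have Q0: "Q (0, r) (0, 0) = 0" if "r < n 0" for r
  proof -
    have "g 0 0 r = 0" using \<open>g 0 0 = 0\<close> by simp
    then show ?thesis using that by (simp add: g_def)
  qed
  \<comment> \<open>Column 0 of the block of \<open>Q\<close> at V_0 is \<open>y\<close> itself,
    since the word was built by starting from \<open>unit_fun 0\<close>.\<close>
  have "y r = 0" for r
  proof (cases "r < n 0")
    case True
    have "y r = (\<Sum>q<n 0. if q = 0 then Q (0, r) (0, q) else 0)"
      unfolding yu[OF True] by (intro sum.cong) (auto simp: Q_def unit_fun_def)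
    then show ?thesis using n0 Q0[OF True] by simp
  next
    case False
    then show ?thesis using y(1) by (simp add: vecs_def)
  qed
  then show False using y(2) by (auto simp: fun_eq_iff)
qed

lemma HH_nonzero_odd_multiple: "HH_nonzero (2 * d) (triv_ext d c) (L * (2 * m + 1) - 1)"
proof -
  obtain u where u: "length u = L * (2 * m + 1)" "set u \<subseteq> {d..<2 * d}" "tr_cochain u \<noteq> 0"
    by (rule tr_cochain_nonzero[of "L * (2 * m + 1)"]) (use L in auto)
  \<comment> \<open>An odd multiple of \<open>L\<close> has the parity of \<open>L\<close>, which
    identifies \<delta> with the sign that the boundary formula needs.\<close>
  have "even (L - 1) = even (L * (2 * m + 1) - 1)" using L by (cases L) auto
  then have \<delta>: "\<delta> = (- 1) ^ (L * (2 * m + 1) - 1)" unfolding \<delta>_def by (rule minus_one_power_parity)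
  show ?thesis
  proof (rule HH_nonzero_if_tr_cochain[OF _ \<delta> u(3)])
    show "u \<in> tuples (2 * d) (L * (2 * m + 1) - 1)" using u(1,2) L by (auto simp: tuples_def)
    fix i j l assume "i \<in> set u" "j \<in> set u"
    then have "d \<le> i" "d \<le> j" using u(2) by auto
    then show "triv_ext d c i j l = 0" by (simp add: triv_ext_def)
  qed
qed

end

theorem theorem3p5:
  fixes c :: "nat \<Rightarrow> nat \<Rightarrow> nat \<Rightarrow> 'k::field" and d :: nat
  assumes "alg_closed TYPE('k)"
    and "d > 0"
    and "fd_algebra d c"
    and "selfinjective d c"
  shows "HHdim_infinite (2 * d) (triv_ext d c)"
proof -
  interpret unital_algebra d c by unfold_locales (rule assms(3))
  show ?thesis
  proof (rule cycle_exists[OF assms(1,2,4)])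
    fix L :: nat and n \<rho> \<sigma>
    assume cycle: "L > 0" "\<And>k. k < L \<Longrightarrow> simple (n k) (\<rho> k)"
      "\<And>k l. k < L \<Longrightarrow> l < L \<Longrightarrow> k \<noteq> l \<Longrightarrow> \<not> similar (n k) (\<rho> k) (n l) (\<rho> l)"
      "\<And>k. k < L \<Longrightarrow> link (n k) (\<rho> k) (n (Suc k mod L)) (\<rho> (Suc k mod L)) (\<sigma> k)"
    interpret module_cycle d c L n \<rho> \<sigma>
      by unfold_locales (use assms(1) cycle in auto)
    have "inj (\<lambda>m. L * (2 * m + 1) - 1)"
    proof (rule injI)
      fix x y assume "L * (2 * x + 1) - 1 = L * (2 * y + 1) - 1"
      moreover have "L * (2 * x + 1) > 0" "L * (2 * y + 1) > 0" using cycle(1) by simp_all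
      ultimately have "L * (2 * x + 1) = L * (2 * y + 1)" by linarith
      then show "x = y" using cycle(1) by simp
    qed
    then have "infinite (range (\<lambda>m. L * (2 * m + 1) - 1))" by (rule range_inj_infinite)
    moreover have "range (\<lambda>m. L * (2 * m + 1) - 1) \<subseteq> {m. HH_nonzero (2 * d) (triv_ext d c) m}"
      using HH_nonzero_odd_multiple by auto
    ultimately show ?thesis unfolding HHdim_infinite_def using infinite_super by blast
  qed
qed

end
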